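(* Let $(X,\Sigma,\mu)$ be a $\sigma$-finite measure space with decomposition $X=B\cup\bigcup_{i\in\mathbb{N}}A_i$ into its non-atomic part $B$ and its pairwise disjoint atoms $A_i$. Let $1\le q<p<\infty$, let $u_1,\dots,u_n:X\to\mathbb{C}$ be measurable functions and $\varphi_1,\dots,\varphi_n:X\to X$ non-singular measurable transformations such that $W=\sum_{r=1}^{n}u_rC_{\varphi_r}$, $Wf=\sum_{r=1}^n u_r\cdot(f\circ\varphi_r)$, is a bounded operator from $L^p(\mu)$ into $L^q(\mu)$. Put $J=\sum_{r=1}^{n}h_r\,E_r(|u_r|^q)\circ\varphi_r^{-1}$. Then: (a) If $W$ has closed range and is injective, then the set $\{i\in\mathbb{N}: J(A_i)>0\}$ is finite. (b) If $J=0$ $\mu$-a.e. on $B$ and the set $\{i\in\mathbb{N}: J(A_i)>0\}$ is finite, then $W$ has closed range.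
   Context: A measurable $\varphi:X\to X$ is non-singular if $\mu\circ\varphi^{-1}$ is absolutely continuous with respect to $\mu$. For each $r$: $h_r=d(\mu\circ\varphi_r^{-1})/d\mu$, and $E_r$ is the conditional expectation with respect to $\varphi_r^{-1}(\Sigma)$, on which $\mu$ is assumed $\sigma$-finite. For non-negative measurable $f$, $E_r(f)\circ\varphi_r^{-1}$ denotes the a.e. unique $\Sigma$-measurable function $F$ that vanishes off $\{h_r\neq0\}$ and satisfies $E_r(f)=F\circ\varphi_r$ $\mu$-a.e. Every $\sigma$-finite measure space decomposes as $X=B\cup\bigcup_i A_i$, with $\{A_i\}$ a countable family of pairwise disjoint atoms of finite measure and $B$ a set, disjoint from them, containing no atoms; a measurable function $f$ is a.e. constant on each atom $A_i$, and $f(A_i)$ denotes this constant value. *)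

theory Defs
  imports "HOL-Probability.Probability"
begin

section \<open>Complex Lebesgue spaces\<close>

definition Lp_fun :: "'a measure \<Rightarrow> real \<Rightarrow> ('a \<Rightarrow> complex) set" where
  "Lp_fun M p = {f \<in> borel_measurable M. integrable M (\<lambda>x. norm (f x) powr p)}"

definition Lp_seminorm :: "'a measure \<Rightarrow> real \<Rightarrow> ('a \<Rightarrow> complex) \<Rightarrow> real" where
  "Lp_seminorm M p f = (\<integral>x. norm (f x) powr p \<partial>M) powr (1 / p)"

definition Lp_rel :: "'a measure \<Rightarrow> real \<Rightarrow> (('a \<Rightarrow> complex) \<times> ('a \<Rightarrow> complex)) set" where
  "Lp_rel M p = {(f, g). f \<in> Lp_fun M p \<and> g \<in> Lp_fun M p \<and> (AE x in M. f x = g x)}"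

definition Lp :: "'a measure \<Rightarrow> real \<Rightarrow> ('a \<Rightarrow> complex) set set" where
  "Lp M p = Lp_fun M p // Lp_rel M p"

text \<open>Norm and distance are computed on chosen representatives; the lemmas below show that
  the choice does not matter and that the distance is a metric when \<open>1 \<le> p\<close>.\<close>

definition Lp_norm :: "'a measure \<Rightarrow> real \<Rightarrow> ('a \<Rightarrow> complex) set \<Rightarrow> real" where
  "Lp_norm M p F = Lp_seminorm M p (SOME f. f \<in> F)"

definition Lp_dist :: "'a measure \<Rightarrow> real \<Rightarrow> ('a \<Rightarrow> complex) set \<Rightarrow> ('a \<Rightarrow> complex) set \<Rightarrow> real" where
  "Lp_dist M p F G = Lp_seminorm M p (\<lambda>x. (SOME f. f \<in> F) x - (SOME g. g \<in> G) x)"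

definition Lp_topology :: "'a measure \<Rightarrow> real \<Rightarrow> ('a \<Rightarrow> complex) set topology" where
  "Lp_topology M p = Metric_space.mtopology (Lp M p) (Lp_dist M p)"

lemma equiv_Lp_rel: "equiv (Lp_fun M p) (Lp_rel M p)"
proof (rule equivI)
  show "Lp_rel M p \<subseteq> Lp_fun M p \<times> Lp_fun M p"
    by (auto simp: Lp_rel_def)
  show "refl_on (Lp_fun M p) (Lp_rel M p)"
    by (auto simp: refl_on_def Lp_rel_def)
  show "sym (Lp_rel M p)"
    by (auto simp: sym_def Lp_rel_def eq_commute)
  show "trans (Lp_rel M p)"
  proof (rule transI)
    fix f g h assume "(f, g) \<in> Lp_rel M p" "(g, h) \<in> Lp_rel M p"
    then show "(f, h) \<in> Lp_rel M p"
      unfolding Lp_rel_def by auto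
  qed
qed

lemma Lp_seminorm_cong:
  assumes "f \<in> borel_measurable M" "g \<in> borel_measurable M" "AE x in M. f x = g x"
  shows "Lp_seminorm M p f = Lp_seminorm M p g"
proof -
  have "(\<integral>x. norm (f x) powr p \<partial>M) = (\<integral>x. norm (g x) powr p \<partial>M)"
    using assms by (intro integral_cong_AE) auto
  then show ?thesis by (simp add: Lp_seminorm_def)
qed

lemma Lp_rep:
  assumes "F \<in> Lp M p"
  shows "(SOME f. f \<in> F) \<in> F" "F \<subseteq> Lp_fun M p" "f \<in> F \<Longrightarrow> Lp_rel M p `` {f} = F"
proof -
  have "F \<noteq> {}"
    using assms equiv_Lp_rel in_quotient_imp_non_empty unfolding Lp_def by blast
  then show "(SOME f. f \<in> F) \<in> F" by (simp add: some_in_eq)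
  show "F \<subseteq> Lp_fun M p"
    using assms equiv_Lp_rel in_quotient_imp_subset unfolding Lp_def by blast
  show "Lp_rel M p `` {f} = F" if "f \<in> F"
    using assms that equiv_Lp_rel
    by (metis Image_singleton_iff Lp_def equiv_class_eq quotientE)
qed

lemma Lp_norm_eq:
  assumes "F \<in> Lp M p" "f \<in> F"
  shows "Lp_norm M p F = Lp_seminorm M p f"
proof -
  let ?r = "SOME f. f \<in> F"
  have "(?r, f) \<in> Lp_rel M p"
    using Lp_rep(3)[OF assms(1) Lp_rep(1)[OF assms(1)]] assms(2) by blast
  then show ?thesis
    unfolding Lp_norm_def by (intro Lp_seminorm_cong) (auto simp: Lp_rel_def Lp_fun_def)
qed

lemma Lp_dist_eq:
  assumes "F \<in> Lp M p" "G \<in> Lp M p" "f \<in> F" "g \<in> G"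
  shows "Lp_dist M p F G = Lp_seminorm M p (\<lambda>x. f x - g x)"
proof -
  let ?r = "SOME f. f \<in> F" and ?s = "SOME g. g \<in> G"
  have r: "(?r, f) \<in> Lp_rel M p"
    using Lp_rep(3)[OF assms(1) Lp_rep(1)[OF assms(1)]] assms(3) by blast
  have s: "(?s, g) \<in> Lp_rel M p"
    using Lp_rep(3)[OF assms(2) Lp_rep(1)[OF assms(2)]] assms(4) by blast
  have "AE x in M. ?r x = f x" "AE x in M. ?s x = g x"
    using r s by (auto simp: Lp_rel_def)
  then have "AE x in M. ?r x - ?s x = f x - g x" by eventually_elim simp
  then show ?thesis
    using r s unfolding Lp_dist_def
    by (intro Lp_seminorm_cong) (auto simp: Lp_rel_def Lp_fun_def)
qed

lemma powr_convex_nonneg: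
  fixes s t l p :: real
  assumes "1 \<le> p" "0 \<le> s" "0 \<le> t" "0 \<le> l" "l \<le> 1"
  shows "((1 - l) * s + l * t) powr p \<le> (1 - l) * s powr p + l * t powr p"
proof -
  have small: "c powr p \<le> c" if "0 \<le> c" "c \<le> 1" for c :: real
    using that assms(1) powr_mono'[of 1 p c] by auto
  show ?thesis
  proof (cases "s = 0 \<or> t = 0")
    case True
    then show ?thesis
      using assms small[of l] small[of "1 - l"]
      by (auto simp: powr_mult intro!: mult_right_mono)
  next
    case False
    then show ?thesis
      using convex_onD[OF powr_convex[OF assms(1)], of l s t] assms by auto
  qed
qed

lemma Lp_Minkowski:
  assumes p: "1 \<le> p" and f: "f \<in> Lp_fun M p" and g: "g \<in> Lp_fun M p"
  shows "(\<lambda>x. f x + g x) \<in> Lp_fun M p"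
    and "Lp_seminorm M p (\<lambda>x. f x + g x) \<le> Lp_seminorm M p f + Lp_seminorm M p g"
proof -
  note [measurable] = f[unfolded Lp_fun_def, simplified, THEN conjunct1]
    g[unfolded Lp_fun_def, simplified, THEN conjunct1]
  have fi: "integrable M (\<lambda>x. norm (f x) powr p)" and gi: "integrable M (\<lambda>x. norm (g x) powr p)"
    using f g by (auto simp: Lp_fun_def)
  have key: "norm (f x + g x) powr p
      \<le> (a + b) powr p * (a / (a + b) * (norm (f x) powr p / a powr p)
                       + b / (a + b) * (norm (g x) powr p / b powr p))"
    if "a > 0" "b > 0" for a b :: real and x
  proof -
    define l where "l = b / (a + b)"
    have l: "0 \<le> l" "l \<le> 1" "1 - l = a / (a + b)"
      using that by (auto simp: l_def field_simps)
    have "norm (f x + g x) powr p \<le> (norm (f x) + norm (g x)) powr p"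
      using p by (intro powr_mono2) (auto intro: norm_triangle_ineq)
    also have "norm (f x) + norm (g x)
        = (a + b) * ((1 - l) * (norm (f x) / a) + l * (norm (g x) / b))"
    proof -
      have "(1 - l) * (norm (f x) / a) = norm (f x) / (a + b)" "l * (norm (g x) / b) = norm (g x) / (a + b)"
        unfolding l(3) using that by (simp_all add: l_def)
      then show ?thesis
        using that by (simp add: add_divide_distrib[symmetric])
    qed
    also have "\<dots> powr p = (a + b) powr p * ((1 - l) * (norm (f x) / a) + l * (norm (g x) / b)) powr p"
      by (rule powr_mult)
    also have "\<dots> \<le> (a + b) powr p *
        ((1 - l) * (norm (f x) / a) powr p + l * (norm (g x) / b) powr p)"
      using that l p by (intro mult_left_mono powr_convex_nonneg) auto
    also have "\<dots> = (a + b) powr p * (a / (a + b) * (norm (f x) powr p / a powr p)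
                       + b / (a + b) * (norm (g x) powr p / b powr p))"
      using that unfolding l(3) by (simp add: l_def powr_divide)
    finally show ?thesis .
  qed
  let ?h = "\<lambda>a b x. (a + b) powr p * (a / (a + b) * (norm (f x) powr p / a powr p)
                       + b / (a + b) * (norm (g x) powr p / b powr p))"
  have hi: "integrable M (?h a b)" for a b :: real
    using fi gi by auto
  have int: "integrable M (\<lambda>x. norm (f x + g x) powr p)"
    by (rule Bochner_Integration.integrable_bound[OF hi[of 1 1]]) (use key[of 1 1] in auto)
  then show "(\<lambda>x. f x + g x) \<in> Lp_fun M p" by (auto simp: Lp_fun_def)
  let ?I = "\<integral>x. norm (f x + g x) powr p \<partial>M"
  have pw: "(Lp_seminorm M p k) powr p = (\<integral>x. norm (k x) powr p \<partial>M)" for k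
    using p by (simp add: Lp_seminorm_def powr_powr)
  have bound: "Lp_seminorm M p (\<lambda>x. f x + g x) \<le> a + b"
    if a: "a > Lp_seminorm M p f" and b: "b > Lp_seminorm M p g" for a b
  proof -
    have nn: "0 \<le> Lp_seminorm M p f" "0 \<le> Lp_seminorm M p g" by (auto simp: Lp_seminorm_def)
    then have ab: "a > 0" "b > 0" using a b by auto
    have fa: "(\<integral>x. norm (f x) powr p \<partial>M) / a powr p \<le> 1"
      using powr_mono2[of p "Lp_seminorm M p f" a] p nn a ab by (simp add: pw divide_le_eq)
    have gb: "(\<integral>x. norm (g x) powr p \<partial>M) / b powr p \<le> 1"
      using powr_mono2[of p "Lp_seminorm M p g" b] p nn b ab by (simp add: pw divide_le_eq)
    have "?I \<le> (\<integral>x. ?h a b x \<partial>M)"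
      by (rule integral_mono[OF int hi]) (use key[OF ab] in auto)
    also have "\<dots> = (a + b) powr p * (a / (a + b) * ((\<integral>x. norm (f x) powr p \<partial>M) / a powr p)
                       + b / (a + b) * ((\<integral>x. norm (g x) powr p \<partial>M) / b powr p))"
      using fi gi by simp
    also have "\<dots> \<le> (a + b) powr p * (a / (a + b) * 1 + b / (a + b) * 1)"
      using ab fa gb by (intro mult_left_mono add_mono) auto
    also have "\<dots> = (a + b) powr p"
      using ab by (simp add: add_divide_distrib[symmetric])
    finally have "?I powr (1 / p) \<le> ((a + b) powr p) powr (1 / p)"
      using p by (intro powr_mono2) auto
    then show ?thesis
      using p ab by (simp add: Lp_seminorm_def powr_powr)
  qed
  show "Lp_seminorm M p (\<lambda>x. f x + g x) \<le> Lp_seminorm M p f + Lp_seminorm M p g"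
  proof (rule field_le_epsilon)
    fix e :: real assume "e > 0"
    then show "Lp_seminorm M p (\<lambda>x. f x + g x) \<le> Lp_seminorm M p f + Lp_seminorm M p g + e"
      using bound[of "Lp_seminorm M p f + e / 2" "Lp_seminorm M p g + e / 2"] by simp
  qed
qed

lemma Lp_fun_diff:
  assumes "1 \<le> p" "f \<in> Lp_fun M p" "g \<in> Lp_fun M p"
  shows "(\<lambda>x. f x - g x) \<in> Lp_fun M p"
proof -
  have "(\<lambda>x. - g x) \<in> Lp_fun M p"
    using assms(3) by (auto simp: Lp_fun_def)
  from Lp_Minkowski(1)[OF assms(1,2) this] show ?thesis by simp
qed

lemma Lp_seminorm_eq_0_iff:
  assumes "1 \<le> p" "f \<in> Lp_fun M p"
  shows "Lp_seminorm M p f = 0 \<longleftrightarrow> (AE x in M. f x = 0)"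
  using assms integral_nonneg_eq_0_iff_AE[of M "\<lambda>x. norm (f x) powr p"]
  by (auto simp: Lp_seminorm_def Lp_fun_def)

lemma Metric_space_Lp:
  assumes p: "1 \<le> p"
  shows "Metric_space (Lp M p) (Lp_dist M p)"
proof
  show "0 \<le> Lp_dist M p F G" for F G
    by (simp add: Lp_dist_def Lp_seminorm_def)
  show "Lp_dist M p F G = Lp_dist M p G F" for F G
    by (simp add: Lp_dist_def Lp_seminorm_def norm_minus_commute)
next
  fix F G assume FG: "F \<in> Lp M p" "G \<in> Lp M p"
  obtain f g where fg: "f \<in> F" "g \<in> G" using Lp_rep(1) FG by metis
  then have L: "f \<in> Lp_fun M p" "g \<in> Lp_fun M p" using Lp_rep(2) FG by blast+
  have "Lp_dist M p F G = 0 \<longleftrightarrow> (AE x in M. f x - g x = 0)"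
    unfolding Lp_dist_eq[OF FG fg] by (rule Lp_seminorm_eq_0_iff[OF p Lp_fun_diff[OF p L]])
  also have "\<dots> \<longleftrightarrow> (f, g) \<in> Lp_rel M p"
    using L by (simp add: Lp_rel_def)
  also have "\<dots> \<longleftrightarrow> F = G"
    using Lp_rep(3)[OF FG(1) fg(1)] Lp_rep(3)[OF FG(2) fg(2)] L fg
    by (metis eq_equiv_class_iff equiv_Lp_rel)
  finally show "Lp_dist M p F G = 0 \<longleftrightarrow> F = G" .
next
  fix F G H assume FGH: "F \<in> Lp M p" "G \<in> Lp M p" "H \<in> Lp M p"
  obtain f g h where fgh: "f \<in> F" "g \<in> G" "h \<in> H" using Lp_rep(1) FGH by metis
  then have L: "f \<in> Lp_fun M p" "g \<in> Lp_fun M p" "h \<in> Lp_fun M p"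
    using Lp_rep(2) FGH by blast+
  show "Lp_dist M p F H \<le> Lp_dist M p F G + Lp_dist M p G H"
    using Lp_Minkowski(2)[OF p Lp_fun_diff[OF p L(1,2)] Lp_fun_diff[OF p L(2,3)]]
    by (simp add: Lp_dist_eq[OF FGH(1,3) fgh(1,3)] Lp_dist_eq[OF FGH(1,2) fgh(1,2)]
        Lp_dist_eq[OF FGH(2,3) fgh(2,3)])
qed


section \<open>Operators between Lebesgue spaces\<close>

text \<open>The map on classes induced by a map on functions. If \<open>T f\<close> is not in \<open>Lp_fun M q\<close> for any
  \<open>f \<in> F\<close>, the result is the empty set, which is not an element of \<open>Lp M q\<close>.\<close>

definition Lp_map :: "'a measure \<Rightarrow> real \<Rightarrow> (('a \<Rightarrow> complex) \<Rightarrow> ('a \<Rightarrow> complex))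
    \<Rightarrow> ('a \<Rightarrow> complex) set \<Rightarrow> ('a \<Rightarrow> complex) set" where
  "Lp_map M q T F = Lp_rel M q `` (T ` F)"

text \<open>Linearity is not included: it is automatic for the operators considered here.\<close>

definition bounded_Lp_operator :: "'a measure \<Rightarrow> real \<Rightarrow> real
    \<Rightarrow> (('a \<Rightarrow> complex) set \<Rightarrow> ('a \<Rightarrow> complex) set) \<Rightarrow> bool" where
  "bounded_Lp_operator M p q W \<longleftrightarrow>
     W \<in> Lp M p \<rightarrow> Lp M q \<and> (\<exists>C. \<forall>F \<in> Lp M p. Lp_norm M q (W F) \<le> C * Lp_norm M p F)"

definition closed_range :: "'a measure \<Rightarrow> real \<Rightarrow> real
    \<Rightarrow> (('a \<Rightarrow> complex) set \<Rightarrow> ('a \<Rightarrow> complex) set) \<Rightarrow> bool" where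
  "closed_range M p q W \<longleftrightarrow> closedin (Lp_topology M q) (W ` Lp M p)"

definition weighted_comp_sum :: "nat \<Rightarrow> (nat \<Rightarrow> 'a \<Rightarrow> complex) \<Rightarrow> (nat \<Rightarrow> 'a \<Rightarrow> 'a)
    \<Rightarrow> ('a \<Rightarrow> complex) \<Rightarrow> ('a \<Rightarrow> complex)" where
  "weighted_comp_sum n u \<phi> f = (\<lambda>x. \<Sum>r = 1..n. u r x * f (\<phi> r x))"


section \<open>Non-singular transformations\<close>

definition nonsingular :: "'a measure \<Rightarrow> ('a \<Rightarrow> 'a) \<Rightarrow> bool" where
  "nonsingular M \<phi> \<longleftrightarrow> \<phi> \<in> measurable M M \<and> absolutely_continuous M (distr M M \<phi>)"

definition RN_comp :: "'a measure \<Rightarrow> ('a \<Rightarrow> 'a) \<Rightarrow> 'a \<Rightarrow> ennreal" where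
  "RN_comp M \<phi> = RN_deriv M (distr M M \<phi>)"

definition pullback_algebra :: "'a measure \<Rightarrow> ('a \<Rightarrow> 'a) \<Rightarrow> 'a measure" where
  "pullback_algebra M \<phi> = vimage_algebra (space M) \<phi> M"

text \<open>\<open>cond_exp_inv M \<phi> f\<close> is the function written $E(f) \circ \varphi^{-1}$: the a.e. unique
  measurable function that vanishes where the Radon-Nikodym derivative does and whose composition
  with \<open>\<phi>\<close> is the conditional expectation of \<open>f\<close>.\<close>

definition cond_exp_inv :: "'a measure \<Rightarrow> ('a \<Rightarrow> 'a) \<Rightarrow> ('a \<Rightarrow> ennreal) \<Rightarrow> 'a \<Rightarrow> ennreal" where
  "cond_exp_inv M \<phi> f = (SOME F. F \<in> borel_measurable M \<and>
     (\<forall>x \<in> space M. RN_comp M \<phi> x = 0 \<longrightarrow> F x = 0) \<and>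
     (AE x in M. nn_cond_exp M (pullback_algebra M \<phi>) f x = F (\<phi> x)))"

definition J_fun :: "'a measure \<Rightarrow> real \<Rightarrow> nat \<Rightarrow> (nat \<Rightarrow> 'a \<Rightarrow> complex) \<Rightarrow> (nat \<Rightarrow> 'a \<Rightarrow> 'a)
    \<Rightarrow> 'a \<Rightarrow> ennreal" where
  "J_fun M q n u \<phi> x = (\<Sum>r = 1..n. RN_comp M (\<phi> r) x *
     cond_exp_inv M (\<phi> r) (\<lambda>y. ennreal (norm (u r y) powr q)) x)"


section \<open>Atoms\<close>

definition is_atom :: "'a measure \<Rightarrow> 'a set \<Rightarrow> bool" where
  "is_atom M A \<longleftrightarrow> A \<in> sets M \<and> emeasure M A > 0 \<and>
     (\<forall>S \<in> sets M. S \<subseteq> A \<longrightarrow> emeasure M S = 0 \<or> emeasure M S = emeasure M A)"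

text \<open>The index set \<open>I\<close> may be finite or infinite, so that every countable family of atoms
  is covered.\<close>

definition atomic_decomposition :: "'a measure \<Rightarrow> 'a set \<Rightarrow> nat set \<Rightarrow> (nat \<Rightarrow> 'a set) \<Rightarrow> bool" where
  "atomic_decomposition M B I A \<longleftrightarrow>
     B \<in> sets M \<and> (\<forall>S. S \<subseteq> B \<longrightarrow> \<not> is_atom M S) \<and>
     (\<forall>i\<in>I. is_atom M (A i) \<and> emeasure M (A i) < \<infinity> \<and> B \<inter> A i = {}) \<and>
     disjoint_family_on A I \<and> space M = B \<union> (\<Union>i\<in>I. A i)"

definition atom_value :: "'a measure \<Rightarrow> ('a \<Rightarrow> 'b) \<Rightarrow> 'a set \<Rightarrow> 'b" where
  "atom_value M f A = (THE c. AE x in M. x \<in> A \<longrightarrow> f x = c)"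

end

theory Submission
  imports Defs "HOL-Library.Function_Algebras"
begin

text \<open>
  (a) If \<open>W\<close> is injective with closed range, the bounded inverse theorem makes it bounded below. Let
  \<open>e\<^sub>i\<close> be the normalized indicators of atoms \<open>A\<^sub>i\<close>, \<open>i \<in> S\<close>. At each point at most \<open>n\<close> of the
  functions \<open>W e\<^sub>i\<close> are nonzero, so averaging over all \<open>R \<subseteq> S\<close> yields an \<open>R\<close> for which
  \<open>W (\<Sum>i\<in>R. e\<^sub>i)\<close> has \<open>q\<close>-norm at least of order \<open>(card S)\<^bsup>1/q\<^esup>\<close>, cancellations between the \<open>n\<close>
  summands of \<open>W\<close> notwithstanding. Since \<open>\<Sum>i\<in>R. e\<^sub>i\<close> has \<open>p\<close>-norm at most \<open>(card S)\<^bsup>1/p\<^esup>\<close> and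
  \<open>q < p\<close>, the cardinality of \<open>S\<close> is bounded. Hence there are only finitely many atoms at all.

  (b) Each summand satisfies \<open>\<integral>|u\<^sub>r|\<^bsup>q\<^esup> (g \<circ> \<phi>\<^sub>r) d\<mu> = \<integral>h\<^sub>r (E\<^sub>r(|u\<^sub>r|\<^bsup>q\<^esup>) \<circ> \<phi>\<^sub>r\<^sup>-\<^sup>1) g d\<mu>\<close> for \<open>g \<ge> 0\<close>,
  so \<open>W f\<close> depends only on the restriction of \<open>f\<close> to \<open>{J > 0}\<close>. That set is a finite union of
  atoms, so the range is finite-dimensional.
\<close>

section \<open>Equivalence of complete seminorms\<close>

text \<open>The carrier is a subspace \<open>X\<close> of the ambient type, since
  \<open>Lp_fun M p\<close> depends on \<open>M\<close> and \<open>p\<close> and so cannot be a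
  type. \<open>N\<close> may vanish at nonzero vectors, as it does for functions that are zero
  almost everywhere.\<close>

locale seminorm_on =
  fixes X :: "'v::real_vector set" and N :: "'v \<Rightarrow> real"
  assumes subspace: "subspace X"
    and triangle: "x \<in> X \<Longrightarrow> y \<in> X \<Longrightarrow> N (x + y) \<le> N x + N y"
    and scale: "x \<in> X \<Longrightarrow> N (c *\<^sub>R x) = \<bar>c\<bar> * N x"
begin

lemma zero: "N 0 = 0"
  using scale[of 0 0] subspace_0[OF subspace] by simp

lemma minus: "x \<in> X \<Longrightarrow> N (- x) = N x"
  using scale[of x "-1"] by simp

lemma nonneg: "x \<in> X \<Longrightarrow> 0 \<le> N x"
  using triangle[of x "- x"] subspace_neg[OF subspace] by (auto simp: zero minus)

lemma triangle_diff: "x \<in> X \<Longrightarrow> y \<in> X \<Longrightarrow> N (x - y) \<le> N x + N y"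
  using triangle[of x "- y"] subspace_neg[OF subspace] by (auto simp: minus)

lemma commute: "x \<in> X \<Longrightarrow> y \<in> X \<Longrightarrow> N (x - y) = N (y - x)"
  using minus[of "x - y"] subspace_diff[OF subspace] by auto

lemma triangle_mid: "x \<in> X \<Longrightarrow> y \<in> X \<Longrightarrow> z \<in> X \<Longrightarrow> N (x - z) \<le> N (x - y) + N (y - z)"
  using triangle[of "x - y" "y - z"] subspace_diff[OF subspace] by auto

text \<open>Closed balls are closed: let k tend to infinity in
  \<open>N (x - y) \<le> N (s k - x) + r\<close>.\<close>

lemma limit_le:
  assumes s: "\<And>k. s k \<in> X" and x: "x \<in> X" "y \<in> X" and lim: "(\<lambda>k. N (s k - x)) \<longlonglongrightarrow> 0"
    and le: "eventually (\<lambda>k. N (s k - y) \<le> r) sequentially"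
  shows "N (x - y) \<le> r"
proof (rule tendsto_lowerbound)
  show "(\<lambda>k. N (s k - x) + r) \<longlonglongrightarrow> r"
    using tendsto_add[OF lim tendsto_const[of r]] by simp
  show "eventually (\<lambda>k. N (x - y) \<le> N (s k - x) + r) sequentially"
    using le
  proof eventually_elim
    case (elim k)
    then show ?case
      using triangle_mid[OF x(1) s[of k] x(2)] commute[OF x(1) s[of k]] by simp
  qed
qed simp

end

text \<open>Completeness is asked of sequences with geometrically decaying steps. The constructions
  below produce such sequences directly, and for them the Riesz-Fischer argument requires no passage
  to subsequences.\<close>

locale complete_seminorm_on = seminorm_on +
  assumes complete: "(\<And>k. s k \<in> X) \<Longrightarrow> (\<And>k. N (s (Suc k) - s k) \<le> K * (1 / 2) ^ k) \<Longrightarrow>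
    \<exists>x\<in>X. (\<lambda>k. N (s k - x)) \<longlonglongrightarrow> 0"

text \<open>Baire category: otherwise nested \<open>b\<close>-balls, the \<open>k\<close>-th one missing \<open>{z. a z \<le> k}\<close>, shrink to a
  point lying in none of these sets, which cover \<open>X\<close>.\<close>

lemma ball_in_closure:
  fixes a b :: "'v::real_vector \<Rightarrow> real"
  assumes "complete_seminorm_on X b"
  shows "\<exists>m::nat. \<exists>x0\<in>X. \<exists>r>0. \<forall>x\<in>X. b (x - x0) < r \<longrightarrow> (\<forall>e>0. \<exists>z\<in>X. a z \<le> m \<and> b (z - x) < e)"
proof (rule ccontr)
  interpret b: complete_seminorm_on X b by fact
  assume neg: "\<not> ?thesis"
  \<comment> \<open>A pair is a centre with a radius. A step shorter than half the radius, followed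
    by a ball of at most half the radius, keeps the balls nested; the bound
    \<open>(1 / 2) ^ k\<close> makes the centres converge.\<close>
  define P where "P k y \<longleftrightarrow> fst y \<in> X \<and> 0 < snd y \<and> snd y \<le> (1 / 2) ^ k" for k :: nat and y :: "'v \<times> real"
  define Q where "Q k y y' \<longleftrightarrow> b (fst y' - fst y) < snd y / 2 \<and> snd y' \<le> snd y / 2 \<and>
      (\<forall>z\<in>X. b (z - fst y') \<le> snd y' \<longrightarrow> \<not> a z \<le> real k)" for k :: nat and y y' :: "'v \<times> real"
  have "\<exists>f. \<forall>k. P k (f k) \<and> Q k (f k) (f (Suc k))"
  proof (rule dependent_nat_choice)
    show "\<exists>y. P 0 y"
      unfolding P_def using subspace_0[OF b.subspace] by (intro exI[of _ "(0, 1)"]) auto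
  next
    fix y k assume y: "P k y"
    then obtain x e where xe: "x \<in> X" "b (x - fst y) < snd y / 2" "e > 0"
        "\<And>z. z \<in> X \<Longrightarrow> a z \<le> real k \<Longrightarrow> b (z - x) \<ge> e"
      using neg unfolding P_def by (metis half_gt_zero linorder_not_less)
    show "\<exists>y'. P (Suc k) y' \<and> Q k y y'"
    proof (intro exI conjI)
      \<comment> \<open>Vectors of \<open>X\<close> with \<open>a z \<le> real k\<close> stay at
        distance at least \<open>e\<close> from \<open>x\<close>, so after halving \<open>e\<close>
        even the closed ball misses them. The limit point is only known to lie in the closed
        balls.\<close>
      show "P (Suc k) (x, min (snd y / 2) (e / 2))"
        using xe y by (auto simp: P_def)
      show "Q k y (x, min (snd y / 2) (e / 2))"
        unfolding Q_def using xe(2,3) xe(4) by fastforce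
    qed
  qed
  then obtain f where f: "\<And>k. P k (f k)" "\<And>k. Q k (f k) (f (Suc k))" by blast
  define s r where "s k = fst (f k)" and "r k = snd (f k)" for k
  have s: "s k \<in> X" and r: "0 < r k" "r k \<le> (1 / 2) ^ k" for k
    using f(1)[of k] by (auto simp: P_def s_def r_def)
  have shrink: "b (s (Suc k) - s k) < r k / 2" "r (Suc k) \<le> r k / 2"
    and far: "z \<in> X \<Longrightarrow> b (z - s (Suc k)) \<le> r (Suc k) \<Longrightarrow> \<not> a z \<le> real k" for k z
    using f(2)[of k] by (auto simp: Q_def s_def r_def)
  have "b (s (Suc k) - s k) \<le> 1 * (1 / 2) ^ k" for k
    using shrink(1)[of k] r[of k] by simp
  then obtain x where x: "x \<in> X" "(\<lambda>k. b (s k - x)) \<longlonglongrightarrow> 0"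
    using b.complete[of s 1] s by blast
  have near: "b (s j - s k) + r j \<le> r k" if "k \<le> j" for j k
    using that
  proof (induction j rule: dec_induct)
    case base
    then show ?case by (simp add: b.zero)
  next
    case (step j)
    have "b (s (Suc j) - s k) \<le> b (s (Suc j) - s j) + b (s j - s k)"
      by (rule b.triangle_mid[OF s s s])
    then show ?case
      using step.IH shrink[of j] by simp
  qed
  have "b (x - s k) \<le> r k" for k
  proof (rule b.limit_le[OF s x(1) s x(2)])
    show "eventually (\<lambda>j. b (s j - s k) \<le> r k) sequentially"
      using eventually_ge_at_top[of k]
    proof eventually_elim
      case (elim j)
      then show ?case using near[of k j] r(1)[of j] by simp
    qed
  qed
  then have "\<not> a x \<le> real k" for k
    using far[OF x(1)] by blast
  then show False
    using real_nat_ceiling_ge by blast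
qed

text \<open>The bounded inverse theorem with the norm of the image transported to the domain, so that
  \<open>b\<close> plays the role of \<open>\<lambda>x. norm (T x)\<close>.\<close>

lemma comparable_complete_seminorms:
  fixes a b :: "'v::real_vector \<Rightarrow> real"
  assumes "complete_seminorm_on X a" "complete_seminorm_on X b"
    and dom: "\<And>x. x \<in> X \<Longrightarrow> b x \<le> C * a x"
    and kernel: "\<And>x. x \<in> X \<Longrightarrow> b x = 0 \<Longrightarrow> a x = 0"
  shows "\<exists>c>0. \<forall>x\<in>X. a x \<le> c * b x"
proof -
  interpret a: complete_seminorm_on X a by fact
  interpret b: complete_seminorm_on X b by fact
  note sub = subspace_add[OF a.subspace] subspace_diff[OF a.subspace] subspace_scale[OF a.subspace]
    subspace_0[OF a.subspace]
  obtain n :: nat and x0 r where n: "x0 \<in> X" "r > 0"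
      "\<And>x e. x \<in> X \<Longrightarrow> b (x - x0) < r \<Longrightarrow> e > 0 \<Longrightarrow> \<exists>z\<in>X. a z \<le> real n \<and> b (z - x) < e"
    using ball_in_closure[OF assms(2), where a = a] by blast
  define m where "m = real n"
  note m = n[folded m_def]
  \<comment> \<open>The ball is moved from \<open>x0\<close> to the origin by subtracting an
    approximant of \<open>x0\<close> from one of \<open>x0 + x\<close>; this doubles the bound
    \<open>m\<close>.\<close>
  have approx0: "\<exists>z\<in>X. a z \<le> 2 * m \<and> b (x - z) < e" if x: "x \<in> X" "b x < r" and e: "e > 0" for x e
  proof -
    obtain z where z: "z \<in> X" "a z \<le> m" "b (z - (x0 + x)) < e / 2"
      using m(3)[of "x0 + x" "e / 2"] x e sub(1)[OF m(1) x(1)] by auto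
    obtain w where w: "w \<in> X" "a w \<le> m" "b (w - x0) < e / 2"
      using m(3)[of "x0" "e / 2"] m(1,2) e by (auto simp: b.zero)
    have "b (x - (z - w)) = b ((w - x0) - (z - (x0 + x)))" by (simp add: algebra_simps)
    also have "\<dots> \<le> b (w - x0) + b (z - (x0 + x))"
      using z w m(1) x by (intro b.triangle_diff sub)
    finally have "b (x - (z - w)) < e" using z w by simp
    moreover have "a (z - w) \<le> 2 * m" using a.triangle_diff[OF z(1) w(1)] z w by simp
    ultimately show ?thesis using sub(2)[OF z(1) w(1)] by blast
  qed
  \<comment> \<open>Rescaling by \<open>t\<close>, with error \<open>r / 2\<close> before rescaling:
    the remainder satisfies the premise again with \<open>t / 2\<close> for \<open>t\<close>, which
    permits iteration.\<close>
  have approx: "\<exists>z. z \<in> X \<and> a z \<le> 2 * m * t \<and> b (x - z) < r * (t / 2)"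
    if x: "x \<in> X" "b x < r * t" and t: "t > 0" for x t
  proof -
    have "b (inverse t *\<^sub>R x) < r"
      using x t by (simp add: b.scale field_simps)
    then obtain z where z: "z \<in> X" "a z \<le> 2 * m" "b (inverse t *\<^sub>R x - z) < r / 2"
      using approx0[of "inverse t *\<^sub>R x" "r / 2"] x m(2) sub(3) by auto
    have "x - t *\<^sub>R z = t *\<^sub>R (inverse t *\<^sub>R x - z)"
      using t by (simp add: algebra_simps)
    then have "b (x - t *\<^sub>R z) = t * b (inverse t *\<^sub>R x - z)"
      using t x z sub by (simp add: b.scale)
    also have "\<dots> < t * (r / 2)"
      using z t by simp
    finally have "b (x - t *\<^sub>R z) < r * (t / 2)" by (simp add: mult.commute)
    moreover have "a (t *\<^sub>R z) \<le> 2 * m * t"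
      using z t by (simp add: a.scale mult.commute)
    ultimately show ?thesis using sub(3)[OF z(1)] by blast
  qed
  \<comment> \<open>Successive approximation: \<open>f k\<close> is the remainder after k
    corrections, \<open>s k\<close> the sum of these corrections. The geometric series bounds
    \<open>a\<close> of the limit \<open>y\<close> by \<open>4 * m\<close>; as \<open>f k\<close>
    tends to 0 under \<open>b\<close>, \<open>dom\<close> yields
    \<open>b (x - y) = 0\<close>.\<close>
  have bound: "a x \<le> 4 * m" if x: "x \<in> X" "b x < r" for x
  proof -
    define P where "P k w \<longleftrightarrow> w \<in> X \<and> b w < r * (1 / 2) ^ k" for k :: nat and w
    define Q where "Q k w w' \<longleftrightarrow> a (w - w') \<le> 2 * m * (1 / 2) ^ k" for k :: nat and w w'
    have "\<exists>f. \<forall>k. (P k (f k) \<and> (k = 0 \<longrightarrow> f k = x)) \<and> Q k (f k) (f (Suc k))"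
    proof (rule dependent_nat_choice)
      show "\<exists>w. P 0 w \<and> (0 = (0::nat) \<longrightarrow> w = x)" using x by (auto simp: P_def)
    next
      fix w and k :: nat assume w: "P k w \<and> (k = 0 \<longrightarrow> w = x)"
      obtain z where z: "z \<in> X" "a z \<le> 2 * m * (1 / 2) ^ k" "b (w - z) < r * ((1 / 2) ^ k / 2)"
        using approx[of w "(1 / 2) ^ k"] w by (auto simp: P_def)
      show "\<exists>w'. (P (Suc k) w' \<and> (Suc k = 0 \<longrightarrow> w' = x)) \<and> Q k w w'"
        using z w sub(2) by (intro exI[of _ "w - z"]) (auto simp: P_def Q_def)
    qed
    then obtain f where f: "\<And>k. P k (f k)" "f 0 = x" "\<And>k. Q k (f k) (f (Suc k))" by metis
    define s where "s k = x - f k" for k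
    have s: "s k \<in> X" for k using f(1) x sub(2) by (auto simp: s_def P_def)
    have step: "a (s (Suc k) - s k) \<le> 2 * m * (1 / 2) ^ k" for k
      using f(3)[of k] by (simp add: s_def Q_def)
    obtain y where y: "y \<in> X" "(\<lambda>k. a (s k - y)) \<longlonglongrightarrow> 0"
      using a.complete[of s, OF s step] by blast
    have "a (s k) \<le> 4 * m * (1 - (1 / 2) ^ k)" for k
    proof (induction k)
      case 0
      then show ?case by (simp add: s_def f a.zero)
    next
      case (Suc k)
      have "a (s (Suc k)) \<le> a (s (Suc k) - s k) + a (s k)"
        using a.triangle[OF sub(2)[OF s s] s, of "Suc k" k k] by simp
      then show ?case using Suc step[of k] by (simp add: algebra_simps)
    qed
    moreover have "4 * m * (1 - (1 / 2) ^ k) \<le> 4 * m" for k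
      by (intro mult_left_le) (auto simp: m_def)
    ultimately have "a (s k - 0) \<le> 4 * m" for k
      using order_trans by (metis (no_types, lifting) diff_zero)
    then have ay: "a (y - 0) \<le> 4 * m"
      by (intro a.limit_le[OF s y(1) sub(4) y(2)]) simp
    have "b (x - y) \<le> r * (1 / 2) ^ k + C * a (s k - y)" for k
    proof -
      have "b (x - y) \<le> b (x - s k) + b (s k - y)"
        using x y s by (intro b.triangle_mid)
      moreover have "b (x - s k) < r * (1 / 2) ^ k"
        using f(1)[of k] by (simp add: s_def P_def)
      ultimately show ?thesis
        using dom[OF sub(2)[OF s[of k] y(1)]] by simp
    qed
    moreover have "(\<lambda>k. r * (1 / 2) ^ k + C * a (s k - y)) \<longlonglongrightarrow> r * 0 + C * 0"
      by (intro tendsto_intros y LIMSEQ_realpow_zero) auto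
    ultimately have "b (x - y) \<le> 0"
      by (intro tendsto_lowerbound[where f = "\<lambda>k. r * (1 / 2) ^ k + C * a (s k - y)"]) auto
    \<comment> \<open>The vectors \<open>x\<close> and \<open>y\<close> may differ;
      \<open>kernel\<close> transfers the vanishing of their difference from \<open>b\<close> to
      \<open>a\<close>.\<close>
    then have "a (x - y) = 0"
      using kernel[OF sub(2)[OF x(1) y(1)]] b.nonneg[OF sub(2)[OF x(1) y(1)]] by simp
    then show ?thesis
      using a.triangle[OF sub(2)[OF x(1) y(1)] y(1)] ay by simp
  qed
  \<comment> \<open>Scaling \<open>x\<close> so that \<open>b\<close> takes the value
    \<open>r / 2\<close> brings it within reach of \<open>bound\<close>. The summand 1 keeps the
    constant positive when \<open>m\<close> is 0.\<close>
  have le: "a x \<le> (8 * m + 1) / r * b x" if x: "x \<in> X" for x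
  proof (cases "b x = 0")
    case True
    then show ?thesis using kernel x by simp
  next
    case False
    then have pos: "b x > 0" using b.nonneg[OF x] by simp
    define t where "t = r / (2 * b x)"
    have t: "t > 0" using pos m(2) by (simp add: t_def)
    have "b (t *\<^sub>R x) = r / 2" using pos t by (simp add: b.scale[OF x]) (simp add: t_def)
    then have "t * a x \<le> 4 * m"
      using bound[of "t *\<^sub>R x"] m(2) t sub(3) x by (simp add: a.scale[OF x])
    then have "r * a x \<le> 8 * m * b x"
      using pos by (simp add: t_def field_simps)
    also have "\<dots> \<le> (8 * m + 1) * b x" using pos by simp
    finally show ?thesis using m(2) by (simp add: field_simps)
  qed
  show ?thesis
    using m(2) le by (intro exI[of _ "(8 * m + 1) / r"]) (auto simp: m_def)
qed

section \<open>Completeness of Lebesgue spaces\<close>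

text \<open>Makes the space of all functions a real vector space, in which \<open>Lp_fun M p\<close>
  is a subspace, so that the results on seminorms apply.\<close>

instantiation "fun" :: (type, real_vector) real_vector
begin

definition scaleR_fun :: "real \<Rightarrow> ('a \<Rightarrow> 'b) \<Rightarrow> 'a \<Rightarrow> 'b" where
  "scaleR_fun c f = (\<lambda>x. c *\<^sub>R f x)"

instance
  by standard (auto simp: scaleR_fun_def fun_eq_iff scaleR_add_right scaleR_add_left)

end

section \<open>Elementary properties of the p-seminorm\<close>

lemma Lp_seminorm_nonneg: "0 \<le> Lp_seminorm M p f"
  by (simp add: Lp_seminorm_def)

lemma Lp_seminorm_minus: "Lp_seminorm M p (\<lambda>x. g x - f x) = Lp_seminorm M p (\<lambda>x. f x - g x)"
  by (simp add: Lp_seminorm_def norm_minus_commute)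

lemma Lp_fun_measurable: "f \<in> Lp_fun M p \<Longrightarrow> f \<in> borel_measurable M"
  by (simp add: Lp_fun_def)

lemma Lp_fun_integrable: "f \<in> Lp_fun M p \<Longrightarrow> integrable M (\<lambda>x. norm (f x) powr p)"
  by (simp add: Lp_fun_def)

lemma Lp_fun_cong:
  assumes "f \<in> Lp_fun M p" "g \<in> borel_measurable M" "AE x in M. f x = g x"
  shows "g \<in> Lp_fun M p"
proof -
  have [measurable]: "f \<in> borel_measurable M" using assms(1) by (rule Lp_fun_measurable)
  have "integrable M (\<lambda>x. norm (f x) powr p) \<longleftrightarrow> integrable M (\<lambda>x. norm (g x) powr p)"
    using assms by (intro integrable_cong_AE) auto
  then show ?thesis using assms by (simp add: Lp_fun_def)
qed

lemma Lp_fun_scale: "f \<in> Lp_fun M p \<Longrightarrow> (\<lambda>x. c * f x) \<in> Lp_fun M p"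
  by (auto simp: Lp_fun_def norm_mult powr_mult)

lemma Lp_seminorm_scale:
  assumes "0 < p"
  shows "Lp_seminorm M p (\<lambda>x. c * f x) = norm c * Lp_seminorm M p f"
  using assms by (simp add: Lp_seminorm_def norm_mult powr_mult powr_powr)

lemma Lp_fun_zero: "(\<lambda>x. 0) \<in> Lp_fun M p"
  by (simp add: Lp_fun_def)

lemma Lp_fun_sum:
  assumes "1 \<le> p" "\<And>i. i \<in> S \<Longrightarrow> f i \<in> Lp_fun M p"
  shows "(\<lambda>x. \<Sum>i\<in>S. f i x) \<in> Lp_fun M p"
  using assms(2)
proof (induction S rule: infinite_finite_induct)
  case (insert i S)
  then show ?case using Lp_Minkowski(1)[OF assms(1), of "f i" M "\<lambda>x. \<Sum>i\<in>S. f i x"] by simp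
qed (simp_all add: Lp_fun_zero)

lemma Lp_seminorm_sum:
  assumes "1 \<le> p" "\<And>i. i \<in> S \<Longrightarrow> f i \<in> Lp_fun M p"
  shows "Lp_seminorm M p (\<lambda>x. \<Sum>i\<in>S. f i x) \<le> (\<Sum>i\<in>S. Lp_seminorm M p (f i))"
  using assms(2)
proof (induction S rule: infinite_finite_induct)
  case (insert i S)
  have "(\<lambda>x. \<Sum>i\<in>S. f i x) \<in> Lp_fun M p"
    using insert by (intro Lp_fun_sum[OF assms(1)]) auto
  then show ?case
    using Lp_Minkowski(2)[OF assms(1), of "f i" M "\<lambda>x. \<Sum>i\<in>S. f i x"] insert by fastforce
qed (simp_all add: Lp_seminorm_def)

lemma Lp_seminorm_powr:
  assumes "0 < p"
  shows "Lp_seminorm M p f powr p = (\<integral>x. norm (f x) powr p \<partial>M)"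
  using assms by (simp add: Lp_seminorm_def powr_powr)

lemma nn_integral_Lp:
  assumes "0 < p" "f \<in> Lp_fun M p"
  shows "(\<integral>\<^sup>+x. ennreal (norm (f x) powr p) \<partial>M) = ennreal (Lp_seminorm M p f powr p)"
  using assms by (simp add: Lp_seminorm_powr nn_integral_eq_integral Lp_fun_def)

lemma Lp_funI_nn_integral:
  assumes p: "0 < p" and [measurable]: "f \<in> borel_measurable M" and c: "0 \<le> c"
    and le: "(\<integral>\<^sup>+x. ennreal (norm (f x) powr p) \<partial>M) \<le> ennreal (c powr p)"
  shows "f \<in> Lp_fun M p" "Lp_seminorm M p f \<le> c"
proof -
  show f: "f \<in> Lp_fun M p"
    using le by (auto simp: Lp_fun_def intro!: integrableI_bounded intro: le_less_trans)
  have "Lp_seminorm M p f powr p \<le> c powr p"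
    using le by (simp add: nn_integral_Lp[OF p f])
  then show "Lp_seminorm M p f \<le> c"
    using p c Lp_seminorm_nonneg[of M p f] by (metis linorder_not_less powr_less_mono2)
qed

text \<open>Fatou's lemma for \<open>norm (f j x) powr p\<close>: the seminorm is lower
  semicontinuous under almost everywhere convergence.\<close>

lemma Lp_Fatou:
  assumes p: "0 < p" and f: "\<And>j::nat. f j \<in> Lp_fun M p" "\<And>j. Lp_seminorm M p (f j) \<le> c"
    and g: "g \<in> borel_measurable M" and lim: "AE x in M. (\<lambda>j. f j x) \<longlonglongrightarrow> g x"
  shows "g \<in> Lp_fun M p" "Lp_seminorm M p g \<le> c"
proof -
  note [measurable] = Lp_fun_measurable[OF f(1)] g
  have c: "0 \<le> c" using f(2)[of 0] Lp_seminorm_nonneg[of M p "f 0"] by simp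
  have "(\<integral>\<^sup>+x. ennreal (norm (g x) powr p) \<partial>M)
      = (\<integral>\<^sup>+x. liminf (\<lambda>j. ennreal (norm (f j x) powr p)) \<partial>M)"
  proof (rule nn_integral_cong_AE)
    show "AE x in M. ennreal (norm (g x) powr p) = liminf (\<lambda>j. ennreal (norm (f j x) powr p))"
      using lim
    proof eventually_elim
      case (elim x)
      have "(\<lambda>j. ennreal (norm (f j x) powr p)) \<longlonglongrightarrow> ennreal (norm (g x) powr p)"
        using elim p by (intro tendsto_ennrealI tendsto_powr2 tendsto_norm) auto
      then show ?case by (rule lim_imp_Liminf[OF sequentially_bot, symmetric])
    qed
  qed
  also have "\<dots> \<le> liminf (\<lambda>j. \<integral>\<^sup>+x. ennreal (norm (f j x) powr p) \<partial>M)"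
    by (rule nn_integral_liminf) measurable
  also have "\<dots> \<le> liminf (\<lambda>j. ennreal (c powr p))"
    using p f by (intro Liminf_mono always_eventually allI)
      (auto simp: nn_integral_Lp intro!: ennreal_leI powr_mono2 Lp_seminorm_nonneg)
  also have "\<dots> = ennreal (c powr p)" by (simp add: Liminf_const)
  finally show "g \<in> Lp_fun M p" "Lp_seminorm M p g \<le> c"
    using Lp_funI_nn_integral[OF p g c] by auto
qed

lemma geometric_half_sum_le: "(\<Sum>k = i..<j. (1 / 2 :: real) ^ k) \<le> 2 * (1 / 2) ^ i"
proof (cases "i \<le> j")
  case True
  then have "(\<Sum>k = i..<j. (1 / 2 :: real) ^ k) = 2 * (1 / 2) ^ i - 2 * (1 / 2) ^ j"
    by (induction j rule: dec_induct) auto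
  then show ?thesis by simp
qed simp

text \<open>Riesz-Fischer: Minkowski's inequality bounds the partial sums of the absolute increments
  in p-norm, monotone convergence makes their total finite almost everywhere, and so
  \<open>s\<close> converges almost everywhere. Fatou's lemma upgrades this to convergence in
  seminorm.\<close>

lemma Lp_complete:
  assumes p: "1 \<le> p" and s: "\<And>k. s k \<in> Lp_fun M p"
    and rapid: "\<And>k. Lp_seminorm M p (\<lambda>x. s (Suc k) x - s k x) \<le> K * (1 / 2) ^ k"
  shows "\<exists>f\<in>Lp_fun M p. (\<lambda>k. Lp_seminorm M p (\<lambda>x. s k x - f x)) \<longlonglongrightarrow> 0"
proof -
  note [measurable] = Lp_fun_measurable[OF s]
  have p0: "0 < p" using p by simp
  have K: "0 \<le> K" using order_trans[OF Lp_seminorm_nonneg rapid[of 0]] by simp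
  \<comment> \<open>The absolute increments are viewed as complex functions so that Minkowski's
    inequality for \<open>Lp_fun\<close> applies to their sums.\<close>
  define d where "d k x = complex_of_real (norm (s (Suc k) x - s k x))" for k x
  have [measurable]: "d k \<in> borel_measurable M" for k unfolding d_def by measurable
  have d: "d k \<in> Lp_fun M p" "Lp_seminorm M p (d k) \<le> K * (1 / 2) ^ k" for k
    using Lp_fun_diff[OF p s s, of "Suc k" k] rapid[of k]
    by (auto simp: d_def Lp_fun_def Lp_seminorm_def)
  define S where "S j x = (\<Sum>k<j. norm (s (Suc k) x - s k x))" for j x
  have S: "(\<integral>\<^sup>+x. ennreal (S j x powr p) \<partial>M) \<le> ennreal ((2 * K) powr p)" for j
  proof -
    have "norm (\<Sum>k<j. d k x) = S j x" for x
      unfolding d_def S_def of_real_sum[symmetric] norm_of_real by (simp add: sum_nonneg)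
    then have eq: "(\<integral>\<^sup>+x. ennreal (S j x powr p) \<partial>M) = ennreal (Lp_seminorm M p (\<lambda>x. \<Sum>k<j. d k x) powr p)"
      using nn_integral_Lp[OF p0 Lp_fun_sum[OF p, where f = d and S = "{..<j}"]] d(1) by simp
    have "Lp_seminorm M p (\<lambda>x. \<Sum>k<j. d k x) \<le> (\<Sum>k<j. K * (1 / 2) ^ k)"
      by (rule order_trans[OF Lp_seminorm_sum[OF p d(1)] sum_mono[OF d(2)]])
    also have "\<dots> \<le> 2 * K"
      using mult_left_mono[OF geometric_half_sum_le[of 0 j] K]
      by (simp add: sum_distrib_left atLeast0LessThan mult.commute)
    finally show ?thesis
      unfolding eq using p0 by (intro ennreal_leI powr_mono2 Lp_seminorm_nonneg) auto
  qed
  have "(\<integral>\<^sup>+x. (SUP j. ennreal (S j x powr p)) \<partial>M) = (SUP j. \<integral>\<^sup>+x. ennreal (S j x powr p) \<partial>M)"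
    using p0 by (intro nn_integral_monotone_convergence_SUP)
      (auto simp: S_def incseq_def le_fun_def intro!: ennreal_leI powr_mono2 sum_mono2 sum_nonneg)
  also have "\<dots> \<le> ennreal ((2 * K) powr p)" using S by (intro SUP_least)
  finally have "AE x in M. (SUP j. ennreal (S j x powr p)) \<noteq> \<infinity>"
    by (intro nn_integral_PInf_AE) (auto simp: S_def top_unique)
  then have AE: "AE x in M. convergent (\<lambda>k. s k x)"
  proof eventually_elim
    case (elim x)
    then obtain c where c: "c \<ge> 0" "(SUP j. ennreal (S j x powr p)) = ennreal c"
      by (cases "SUP j. ennreal (S j x powr p)") auto
    have "S j x \<le> c powr (1 / p)" for j
    proof -
      have "ennreal (S j x powr p) \<le> ennreal c" unfolding c(2)[symmetric] by (rule SUP_upper) simp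
      then have "(S j x powr p) powr (1 / p) \<le> c powr (1 / p)"
        using c p0 by (intro powr_mono2) auto
      then show ?thesis using p0 by (simp add: powr_powr S_def sum_nonneg)
    qed
    then have "summable (\<lambda>k. norm (s (Suc k) x - s k x))"
      unfolding S_def by (intro summableI_nonneg_bounded) auto
    then have "summable (\<lambda>k. s (Suc k) x - s k x)" by (rule summable_norm_cancel)
    then have "convergent (\<lambda>n. \<Sum>k<n. s (Suc k) x - s k x)"
      by (simp add: summable_iff_convergent)
    then have "convergent (\<lambda>n. (\<Sum>k<n. s (Suc k) x - s k x) + s 0 x)"
      by (intro convergent_add convergent_const)
    then show ?case by (simp add: sum_lessThan_telescope[of "\<lambda>k. s k x"])
  qed
  define f where "f x = lim (\<lambda>k. s k x)" for x
  have [measurable]: "f \<in> borel_measurable M" unfolding f_def by measurable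
  have lim: "AE x in M. (\<lambda>k. s k x) \<longlonglongrightarrow> f x"
    using AE by eventually_elim (simp add: f_def convergent_LIMSEQ_iff)
  have tail: "Lp_seminorm M p (\<lambda>x. s j x - s i x) \<le> 2 * K * (1 / 2) ^ i" if "i \<le> j" for i j
  proof -
    have "Lp_seminorm M p (\<lambda>x. s j x - s i x) = Lp_seminorm M p (\<lambda>x. \<Sum>k = i..<j. s (Suc k) x - s k x)"
      using that by (simp only: sum_Suc_diff'[of i j "\<lambda>k. s k _"])
    also have "\<dots> \<le> (\<Sum>k = i..<j. K * (1 / 2) ^ k)"
      by (rule order_trans[OF Lp_seminorm_sum[OF p] sum_mono[OF rapid]])
        (intro Lp_fun_diff p s)
    also have "\<dots> \<le> 2 * K * (1 / 2) ^ i"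
      using mult_left_mono[OF geometric_half_sum_le[of i j] K]
      by (simp add: sum_distrib_left mult_ac)
    finally show ?thesis .
  qed
  \<comment> \<open>Fatou's lemma in j, with i fixed, passes the bound \<open>tail\<close> to the
    limit; the shift of the sequence by i makes that bound valid for every index.\<close>
  have diff: "(\<lambda>x. f x - s i x) \<in> Lp_fun M p"
    "Lp_seminorm M p (\<lambda>x. f x - s i x) \<le> 2 * K * (1 / 2) ^ i" for i
  proof -
    have "AE x in M. (\<lambda>j. s (j + i) x - s i x) \<longlonglongrightarrow> f x - s i x"
      using lim by eventually_elim (intro tendsto_intros LIMSEQ_ignore_initial_segment)
    then show "(\<lambda>x. f x - s i x) \<in> Lp_fun M p"
      "Lp_seminorm M p (\<lambda>x. f x - s i x) \<le> 2 * K * (1 / 2) ^ i"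
      using Lp_Fatou[OF p0 Lp_fun_diff[OF p s s] tail, of i "\<lambda>j. j + i"] by auto
  qed
  show ?thesis
  proof (rule bexI)
    show "f \<in> Lp_fun M p" using Lp_Minkowski(1)[OF p diff(1)[of 0] s[of 0]] by simp
    have "(\<lambda>i. 2 * K * (1 / 2) ^ i) \<longlonglongrightarrow> 2 * K * 0"
      by (intro tendsto_intros LIMSEQ_realpow_zero) auto
    then have "(\<lambda>i. 2 * K * (1 / 2) ^ i) \<longlonglongrightarrow> 0" by simp
    then show "(\<lambda>k. Lp_seminorm M p (\<lambda>x. s k x - f x)) \<longlonglongrightarrow> 0"
      unfolding Lp_seminorm_minus[of M p "s _" f]
      by (rule tendsto_sandwich[OF _ _ tendsto_const, rotated 2])
        (simp_all only: Lp_seminorm_nonneg diff(2) eventually_True)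
  qed
qed

lemma subspace_Lp_fun:
  assumes "1 \<le> p"
  shows "subspace (Lp_fun M p)"
  using Lp_Minkowski(1)[OF assms] Lp_fun_scale[of _ M p "complex_of_real _"] Lp_fun_zero
  by (auto simp: subspace_def plus_fun_def zero_fun_def scaleR_fun_def scaleR_conv_of_real)

lemma seminorm_on_Lp:
  assumes "1 \<le> p"
  shows "seminorm_on (Lp_fun M p) (Lp_seminorm M p)"
proof
  show "subspace (Lp_fun M p)" using assms by (rule subspace_Lp_fun)
  show "Lp_seminorm M p (f + g) \<le> Lp_seminorm M p f + Lp_seminorm M p g"
    if "f \<in> Lp_fun M p" "g \<in> Lp_fun M p" for f g
    using Lp_Minkowski(2)[OF assms that] by (simp add: plus_fun_def)
  show "Lp_seminorm M p (c *\<^sub>R f) = \<bar>c\<bar> * Lp_seminorm M p f" for f c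
    using Lp_seminorm_scale[of p M "complex_of_real c" f] assms
    by (simp add: scaleR_fun_def scaleR_conv_of_real)
qed

lemma complete_seminorm_on_Lp:
  assumes "1 \<le> p"
  shows "complete_seminorm_on (Lp_fun M p) (Lp_seminorm M p)"
proof -
  interpret seminorm_on "Lp_fun M p" "Lp_seminorm M p" using assms by (rule seminorm_on_Lp)
  show ?thesis
    by standard (unfold fun_diff_def, rule Lp_complete[OF assms])
qed

text \<open>Induction on \<open>S\<close>. A new vector that depends on the others is absorbed into
  their coefficients. Otherwise its positive distance from their span controls its coefficient,
  which therefore converges and can be split off.\<close>

lemma finite_span_closed:
  assumes p: "1 \<le> p" and "finite S" and v: "\<And>i. i \<in> S \<Longrightarrow> v i \<in> Lp_fun M p"
    and g: "g \<in> Lp_fun M p"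
    and lim: "(\<lambda>k. Lp_seminorm M p (\<lambda>x. (\<Sum>i\<in>S. c k i * v i x) - g x)) \<longlonglongrightarrow> 0"
  shows "\<exists>d. AE x in M. g x = (\<Sum>i\<in>S. d i * v i x)"
  using assms(2) v g lim
proof (induction S arbitrary: c g rule: finite_induct)
  case empty
  then have "Lp_seminorm M p (\<lambda>x. 0 - g x) = 0"
    using LIMSEQ_unique[OF tendsto_const] by simp
  then have "AE x in M. 0 - g x = 0"
    using Lp_seminorm_eq_0_iff[OF p Lp_fun_diff[OF p Lp_fun_zero empty(2)]] by blast
  then show ?case by simp
next
  case (insert j S)
  let ?N = "Lp_seminorm M p"
  have v: "v j \<in> Lp_fun M p" "\<And>i. i \<in> S \<Longrightarrow> v i \<in> Lp_fun M p" using insert.prems by auto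
  have comb: "(\<lambda>x. \<Sum>i\<in>S. d i * v i x) \<in> Lp_fun M p" for d
    by (intro Lp_fun_sum p Lp_fun_scale v)
  have full: "(\<lambda>x. \<Sum>i\<in>insert j S. d i * v i x) \<in> Lp_fun M p" for d
    by (intro Lp_fun_sum p Lp_fun_scale insert.prems)
  show ?case
  proof (cases "\<exists>d. AE x in M. v j x = (\<Sum>i\<in>S. d i * v i x)")
    case True
    then obtain d where d: "AE x in M. v j x = (\<Sum>i\<in>S. d i * v i x)" by blast
    have eq: "AE x in M. (\<Sum>i\<in>insert j S. b i * v i x) = (\<Sum>i\<in>S. (b i + b j * d i) * v i x)" for b
      using d
    proof eventually_elim
      case (elim x)
      then show ?case
        using insert.hyps by (simp add: sum.distrib sum_distrib_left algebra_simps)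
    qed
    have "?N (\<lambda>x. (\<Sum>i\<in>insert j S. c k i * v i x) - g x)
        = ?N (\<lambda>x. (\<Sum>i\<in>S. (c k i + c k j * d i) * v i x) - g x)" for k
      using eq[of "c k"]
      by (intro Lp_seminorm_cong Lp_fun_measurable[OF Lp_fun_diff[OF p]] comb full insert.prems) auto
    then have "\<exists>d'. AE x in M. g x = (\<Sum>i\<in>S. d' i * v i x)"
      using insert.prems(3) by (intro insert.IH[OF v(2) insert.prems(2)]) auto
    then obtain d' where "AE x in M. g x = (\<Sum>i\<in>S. d' i * v i x)" by blast
    then have "AE x in M. g x = (\<Sum>i\<in>insert j S. (d'(j := 0)) i * v i x)"
    proof eventually_elim
      case (elim x)
      have "(\<Sum>i\<in>S. d' i * v i x) = (\<Sum>i\<in>S. (d'(j := 0)) i * v i x)"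
        using insert.hyps by (intro sum.cong) auto
      then show ?case using insert.hyps elim by simp
    qed
    then show ?thesis by blast
  next
    case False
    \<comment> \<open>At distance 0 from the span of the others, \<open>v j\<close> would be a limit
      of their combinations and hence, by the induction hypothesis, one of them.\<close>
    have "\<exists>\<delta>>0. \<forall>d. \<delta> \<le> ?N (\<lambda>x. (\<Sum>i\<in>S. d i * v i x) - v j x)"
    proof (rule ccontr)
      assume "\<not> ?thesis"
      then have "\<forall>k. \<exists>d. ?N (\<lambda>x. (\<Sum>i\<in>S. d i * v i x) - v j x) < inverse (real (Suc k))"
        by (meson inverse_positive_iff_positive linorder_not_less of_nat_0_less_iff zero_less_Suc)
      then obtain d where d: "\<And>k. ?N (\<lambda>x. (\<Sum>i\<in>S. d k i * v i x) - v j x) < inverse (real (Suc k))"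
        by metis
      have "(\<lambda>k. ?N (\<lambda>x. (\<Sum>i\<in>S. d k i * v i x) - v j x)) \<longlonglongrightarrow> 0"
        by (rule tendsto_sandwich[OF _ _ tendsto_const LIMSEQ_inverse_real_of_nat])
          (simp_all only: Lp_seminorm_nonneg less_imp_le[OF d] eventually_True)
      then show False using insert.IH[OF v(2) v(1)] False by blast
    qed
    then obtain \<delta> where \<delta>: "\<delta> > 0" "\<And>d. \<delta> \<le> ?N (\<lambda>x. (\<Sum>i\<in>S. d i * v i x) - v j x)" by blast
    \<comment> \<open>Factoring out \<open>- b j\<close> leaves an element of the span minus
      \<open>v j\<close>, whose seminorm is at least \<delta>.\<close>
    have coeff: "norm (b j) * \<delta> \<le> ?N (\<lambda>x. \<Sum>i\<in>insert j S. b i * v i x)" for b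
    proof (cases "b j = 0")
      case False
      have "(\<Sum>i\<in>insert j S. b i * v i x) = - b j * ((\<Sum>i\<in>S. (- b i / b j) * v i x) - v j x)" for x
        using insert.hyps False by (simp add: sum_distrib_left right_diff_distrib sum_negf)
      then have "?N (\<lambda>x. \<Sum>i\<in>insert j S. b i * v i x)
          = norm (- b j) * ?N (\<lambda>x. (\<Sum>i\<in>S. (- b i / b j) * v i x) - v j x)"
        using p by (simp only: Lp_seminorm_scale)
      then show ?thesis using \<delta>(2)[of "\<lambda>i. - b i / b j"] by (simp add: mult_left_mono)
    qed (simp add: Lp_seminorm_nonneg)
    define E where "E k = ?N (\<lambda>x. (\<Sum>i\<in>insert j S. c k i * v i x) - g x)" for k
    have E: "E \<longlonglongrightarrow> 0" using insert.prems(3) by (simp add: E_def[abs_def])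
    interpret seminorm_on "Lp_fun M p" ?N using p by (rule seminorm_on_Lp)
    have dist: "norm (c k j - c l j) * \<delta> \<le> E k + E l" for k l
    proof -
      have "norm (c k j - c l j) * \<delta> \<le> ?N (\<lambda>x. \<Sum>i\<in>insert j S. (c k i - c l i) * v i x)"
        by (rule coeff)
      also have "\<dots> = ?N (\<lambda>x. (\<Sum>i\<in>insert j S. c k i * v i x) - (\<Sum>i\<in>insert j S. c l i * v i x))"
        by (simp add: left_diff_distrib sum_subtractf)
      also have "\<dots> \<le> E k + E l"
        using triangle_mid[OF full[of "c k"] insert.prems(2) full[of "c l"]]
          commute[OF full[of "c l"] insert.prems(2)]
        by (simp add: E_def fun_diff_def)
      finally show ?thesis .
    qed
    have "Cauchy (\<lambda>k. c k j)"
    proof (rule CauchyI)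
      fix e :: real assume "e > 0"
      then have "eventually (\<lambda>k. E k < e * \<delta> / 2) sequentially"
        using E \<delta>(1) by (intro order_tendstoD) auto
      then obtain K where K: "\<And>k. k \<ge> K \<Longrightarrow> E k < e * \<delta> / 2"
        by (auto simp: eventually_sequentially)
      have "norm (c k j - c l j) < e" if "k \<ge> K" "l \<ge> K" for k l
      proof -
        have "norm (c k j - c l j) * \<delta> < e * \<delta>"
          using dist[of k l] K[OF that(1)] K[OF that(2)] by linarith
        then show ?thesis using \<delta>(1) by simp
      qed
      then show "\<exists>K. \<forall>k\<ge>K. \<forall>l\<ge>K. norm (c k j - c l j) < e" by blast
    qed
    then obtain t where t: "(\<lambda>k. c k j) \<longlonglongrightarrow> t"
      using Cauchy_convergent convergent_def by blast
    \<comment> \<open>With the limiting multiple of \<open>v j\<close> removed, the remaining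
      combinations run over \<open>S\<close> only and converge to \<open>h\<close>.\<close>
    define h where "h x = g x - t * v j x" for x
    have h: "h \<in> Lp_fun M p"
      unfolding h_def[abs_def] by (intro Lp_fun_diff p insert.prems Lp_fun_scale v)
    have "?N (\<lambda>x. (\<Sum>i\<in>S. c k i * v i x) - h x) \<le> E k + norm (t - c k j) * ?N (v j)" for k
    proof -
      have "(\<Sum>i\<in>S. c k i * v i x) - h x
          = ((\<Sum>i\<in>insert j S. c k i * v i x) - g x) + (t - c k j) * v j x" for x
        using insert.hyps by (simp add: h_def left_diff_distrib)
      then have "?N (\<lambda>x. (\<Sum>i\<in>S. c k i * v i x) - h x)
          = ?N (\<lambda>x. ((\<Sum>i\<in>insert j S. c k i * v i x) - g x) + (t - c k j) * v j x)" by (simp only:)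
      also have "\<dots> \<le> E k + ?N (\<lambda>x. (t - c k j) * v j x)"
        unfolding E_def by (intro Lp_Minkowski p Lp_fun_diff full insert.prems Lp_fun_scale v)
      finally show ?thesis using p by (simp add: Lp_seminorm_scale)
    qed
    note upper = this
    have "(\<lambda>k. E k + norm (t - c k j) * ?N (v j)) \<longlonglongrightarrow> 0 + norm (t - t) * ?N (v j)"
      by (intro tendsto_intros E t)
    then have "(\<lambda>k. E k + norm (t - c k j) * ?N (v j)) \<longlonglongrightarrow> 0" by simp
    then have "(\<lambda>k. ?N (\<lambda>x. (\<Sum>i\<in>S. c k i * v i x) - h x)) \<longlonglongrightarrow> 0"
      by (rule tendsto_sandwich[OF _ _ tendsto_const, rotated 2])
        (simp_all only: Lp_seminorm_nonneg upper eventually_True)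
    then obtain d where "AE x in M. h x = (\<Sum>i\<in>S. d i * v i x)"
      using insert.IH[OF v(2) h] by blast
    then have "AE x in M. g x = (\<Sum>i\<in>insert j S. (d(j := t)) i * v i x)"
    proof eventually_elim
      case (elim x)
      have "(\<Sum>i\<in>S. d i * v i x) = (\<Sum>i\<in>S. (d(j := t)) i * v i x)"
        using insert.hyps by (intro sum.cong) auto
      then show ?case using insert.hyps elim by (simp add: h_def algebra_simps)
    qed
    then show ?thesis by blast
  qed
qed

section \<open>Atoms and conditional expectations\<close>

text \<open>Some point y of \<open>A\<close> avoids all basic open sets with null preimage in
  \<open>A\<close>, as there are countably many of them. Every basic neighbourhood of
  \<open>f y\<close> then has full preimage, and by the T1 axiom these neighbourhoods intersect in
  the single point \<open>f y\<close>. The type classes admit both complex functions and the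
  \<open>ennreal\<close>-valued J.\<close>

lemma atom_AE_const:
  fixes f :: "'a \<Rightarrow> 'b::{second_countable_topology, t1_space}"
  assumes A: "is_atom M A" "emeasure M A < \<infinity>" and [measurable]: "f \<in> borel_measurable M"
  shows "\<exists>!c. AE x in M. x \<in> A \<longrightarrow> f x = c"
proof -
  have [measurable]: "A \<in> sets M" and pos: "emeasure M A > 0" using A by (auto simp: is_atom_def)
  have space: "A \<subseteq> space M" by (rule sets.sets_into_space) measurable
  have AE_iff: "(AE x in M. x \<in> A \<longrightarrow> P x) \<longleftrightarrow> emeasure M {x \<in> A. \<not> P x} = 0"
    if "{x \<in> A. \<not> P x} \<in> sets M" for P
    using AE_iff_measurable[OF that, of "\<lambda>x. x \<in> A \<longrightarrow> P x"] space by auto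
  obtain \<B> :: "'b set set" where \<B>: "countable \<B>" "topological_basis \<B>"
    using ex_countable_basis by blast
  have op: "open U" if "U \<in> \<B>" for U using topological_basis_open[OF \<B>(2) that] .
  have meas: "{x \<in> A. f x \<in> U} \<in> sets M" if "open U" for U
  proof -
    have "{x \<in> A. f x \<in> U} = A \<inter> (f -` U \<inter> space M)" using space by auto
    then show ?thesis using that by simp
  qed
  define \<N> where "\<N> = {U \<in> \<B>. emeasure M {x \<in> A. f x \<in> U} = 0}"
  have cN: "countable \<N>" unfolding \<N>_def by (rule countable_subset[OF _ \<B>(1)]) auto
  have "AE x in M. x \<in> A \<longrightarrow> f x \<notin> U" if "U \<in> \<N>" for U
    using that AE_iff[of "\<lambda>x. f x \<notin> U"] meas op by (auto simp: \<N>_def)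
  then have avoid: "AE x in M. \<forall>U\<in>\<N>. x \<in> A \<longrightarrow> f x \<notin> U"
    unfolding AE_ball_countable[OF cN] by blast
  have nonnull: "\<not> (AE x in M. x \<in> A \<longrightarrow> False)"
    using AE_iff[of "\<lambda>_. False"] pos by auto
  have "\<exists>y\<in>A. \<forall>U\<in>\<N>. f y \<notin> U"
  proof (rule ccontr)
    assume none: "\<not> ?thesis"
    have "AE x in M. x \<in> A \<longrightarrow> False"
      using avoid by eventually_elim (use none in blast)
    with nonnull show False by contradiction
  qed
  then obtain y where y: "y \<in> A" "\<And>U. U \<in> \<N> \<Longrightarrow> f y \<notin> U" by blast
  define c where "c = f y"
  define \<F> where "\<F> = {U \<in> \<B>. c \<in> U}"
  have cF: "countable \<F>" unfolding \<F>_def by (rule countable_subset[OF _ \<B>(1)]) auto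
  have full: "AE x in M. x \<in> A \<longrightarrow> f x \<in> U" if U: "U \<in> \<F>" for U
  proof -
    have "emeasure M {x \<in> A. f x \<in> U} \<noteq> 0"
      using U y(2)[of U] by (auto simp: \<F>_def \<N>_def c_def)
    then have "emeasure M {x \<in> A. f x \<in> U} = emeasure M A"
      using A(1) meas[OF op, of U] U by (auto simp: is_atom_def \<F>_def)
    moreover have "{x \<in> A. f x \<notin> U} = A - {x \<in> A. f x \<in> U}" by auto
    \<comment> \<open>The finite measure of \<open>A\<close> allows the subtraction that makes the
      complement null.\<close>
    ultimately have "{x \<in> A. f x \<notin> U} \<in> sets M" "emeasure M {x \<in> A. f x \<notin> U} = 0"
      using A(2) meas[OF op, of U] U emeasure_Diff[of M "{x \<in> A. f x \<in> U}" A]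
      by (auto simp: \<F>_def)
    then show ?thesis by (simp add: AE_iff)
  qed
  then have "AE x in M. \<forall>U\<in>\<F>. x \<in> A \<longrightarrow> f x \<in> U"
    unfolding AE_ball_countable[OF cF] by blast
  then have const: "AE x in M. x \<in> A \<longrightarrow> f x = c"
  proof eventually_elim
    case (elim x)
    show ?case
    proof (intro impI, rule ccontr)
      assume x: "x \<in> A" "f x \<noteq> c"
      then obtain V where V: "open V" "c \<in> V" "f x \<notin> V" using t1_space[of c "f x"] by blast
      then obtain U where "U \<in> \<B>" "c \<in> U" "U \<subseteq> V" using \<B>(2) topological_basisE by metis
      then show False using elim x V by (auto simp: \<F>_def)
    qed
  qed
  show ?thesis
  proof (rule ex1I[of _ c])
    show "AE x in M. x \<in> A \<longrightarrow> f x = c" by (rule const)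
    fix d assume "AE x in M. x \<in> A \<longrightarrow> f x = d"
    with const have "d \<noteq> c \<Longrightarrow> AE x in M. x \<in> A \<longrightarrow> False"
      by eventually_elim auto
    with nonnull show "d = c" by blast
  qed
qed

lemma atom_value_AE:
  fixes f :: "'a \<Rightarrow> 'b::{second_countable_topology, t1_space}"
  assumes "is_atom M A" "emeasure M A < \<infinity>" "f \<in> borel_measurable M"
  shows "AE x in M. x \<in> A \<longrightarrow> f x = atom_value M f A"
  unfolding atom_value_def by (rule theI'[OF atom_AE_const[OF assms]])

section \<open>Integration along one non-singular transformation\<close>

context
  fixes M :: "'a measure" and \<phi> :: "'a \<Rightarrow> 'a"
  assumes sigma_finite: "sigma_finite_measure M"
    and nonsingular: "nonsingular M \<phi>"
    and subalgebra: "sigma_finite_subalgebra M (pullback_algebra M \<phi>)"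
begin

interpretation sigma_finite_measure M by (rule sigma_finite)
interpretation E: sigma_finite_subalgebra M "pullback_algebra M \<phi>" by (rule subalgebra)

lemma measurable_nonsingular: "\<phi> \<in> measurable M M"
  using nonsingular by (simp add: nonsingular_def)

lemma measurable_pullback: "\<phi> \<in> measurable (pullback_algebra M \<phi>) M"
  unfolding pullback_algebra_def
  by (rule measurable_vimage_algebra1) (use measurable_space[OF measurable_nonsingular] in auto)

lemma sets_pullback_algebra: "sets (pullback_algebra M \<phi>) = {\<phi> -` C \<inter> space M |C. C \<in> sets M}"
  unfolding pullback_algebra_def
  by (rule sets_vimage_algebra2) (use measurable_space[OF measurable_nonsingular] in auto)

text \<open>A countable cover by sets of finite measure in the pullback algebra consists of
  preimages of sets \<open>C a\<close>, which have the same measure under the image measure. The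
  part of the space outside all \<open>C a\<close> has empty preimage and is null.\<close>

lemma sigma_finite_distr: "sigma_finite_measure (distr M M \<phi>)"
proof -
  note [measurable] = measurable_nonsingular
  let ?R = "restr_to_subalg M (pullback_algebra M \<phi>)"
  interpret R: sigma_finite_measure ?R by (rule E.sigma_fin_subalg)
  obtain \<A> where \<A>: "countable \<A>" "\<A> \<subseteq> sets ?R" "\<Union>\<A> = space ?R" "\<forall>a\<in>\<A>. emeasure ?R a \<noteq> \<infinity>"
    using R.sigma_finite_countable by blast
  have "\<forall>a\<in>\<A>. \<exists>C\<in>sets M. a = \<phi> -` C \<inter> space M"
    using \<A>(2) by (auto simp: sets_restr_to_subalg[OF E.subalg] sets_pullback_algebra)
  then obtain C where C: "\<And>a. a \<in> \<A> \<Longrightarrow> C a \<in> sets M" "\<And>a. a \<in> \<A> \<Longrightarrow> a = \<phi> -` C a \<inter> space M"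
    by metis
  let ?rest = "space M - (\<Union>a\<in>\<A>. C a)"
  have rest: "?rest \<in> sets M" using C(1) \<A>(1) by (intro sets.Diff sets.countable_UN') auto
  have "\<phi> -` ?rest \<inter> space M = {}"
    using \<A>(3) C(2) by (auto simp: space_restr_to_subalg)
  then have "emeasure (distr M M \<phi>) ?rest = 0" using rest by (simp add: emeasure_distr)
  moreover have "emeasure (distr M M \<phi>) (C a) \<noteq> \<infinity>" if "a \<in> \<A>" for a
  proof -
    have "emeasure (distr M M \<phi>) (C a) = emeasure M a"
      using C(1)[OF that] C(2)[OF that] by (simp add: emeasure_distr)
    also have "\<dots> = emeasure ?R a"
      using that \<A>(2) by (intro emeasure_restr_to_subalg[OF E.subalg, symmetric])
        (auto simp: sets_restr_to_subalg[OF E.subalg])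
    finally show ?thesis using \<A>(4) that by simp
  qed
  ultimately show ?thesis
    using C(1) \<A>(1) rest sets.sets_into_space[OF C(1)]
    by (intro sigma_finite_measure.intro exI[of _ "insert ?rest (C ` \<A>)"]) auto
qed

lemma RN_comp_measurable [measurable]: "RN_comp M \<phi> \<in> borel_measurable M"
  by (simp add: RN_comp_def)

lemma RN_comp_finite: "AE x in M. RN_comp M \<phi> x \<noteq> \<infinity>"
  unfolding RN_comp_def
  using nonsingular sigma_finite_distr by (intro RN_deriv_finite) (auto simp: nonsingular_def)

lemma nn_integral_RN_comp:
  assumes "g \<in> borel_measurable M"
  shows "(\<integral>\<^sup>+x. g (\<phi> x) \<partial>M) = (\<integral>\<^sup>+x. RN_comp M \<phi> x * g x \<partial>M)"
proof -
  note [measurable] = measurable_nonsingular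
  have "(\<integral>\<^sup>+x. g (\<phi> x) \<partial>M) = (\<integral>\<^sup>+x. g x \<partial>distr M M \<phi>)"
    using assms by (simp add: nn_integral_distr)
  also have "\<dots> = (\<integral>\<^sup>+x. RN_comp M \<phi> x * g x \<partial>M)"
    unfolding RN_comp_def using nonsingular assms
    by (intro RN_deriv_nn_integral) (auto simp: nonsingular_def)
  finally show ?thesis .
qed

text \<open>The witness for the choice in \<open>cond_exp_inv\<close> is the quotient of the densities of
  \<open>(f\<mu>) \<circ> \<phi>\<^sup>-\<^sup>1\<close> and \<open>\<mu> \<circ> \<phi>\<^sup>-\<^sup>1\<close>, the latter of which is a.e. finite because \<open>\<mu>\<close> is sigma-finite
  on the pullback algebra.\<close>

lemma cond_exp_inv:
  assumes f [measurable]: "f \<in> borel_measurable M"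
  shows "cond_exp_inv M \<phi> f \<in> borel_measurable M"
    and "AE x in M. nn_cond_exp M (pullback_algebra M \<phi>) f x = cond_exp_inv M \<phi> f (\<phi> x)"
proof -
  note [measurable] = measurable_nonsingular
  define h where "h = RN_comp M \<phi>"
  define N where "N = distr (density M f) M \<phi>"
  define k where "k = RN_deriv M N"
  \<comment> \<open>The value 0 at zeros of \<open>h\<close> is the normalization prescribed in
    \<open>cond_exp_inv\<close>.\<close>
  define F where "F x = (if h x = 0 then 0 else k x / h x)" for x
  have [measurable]: "h \<in> borel_measurable M" "k \<in> borel_measurable M"
    by (auto simp: h_def k_def)
  have [measurable]: "F \<in> borel_measurable M" unfolding F_def by measurable
  have N: "(\<integral>\<^sup>+x. g x \<partial>N) = (\<integral>\<^sup>+x. f x * g (\<phi> x) \<partial>M)" if [measurable]: "g \<in> borel_measurable M" for g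
    unfolding N_def by (simp add: nn_integral_distr nn_integral_density)
  have emN: "emeasure N C = (\<integral>\<^sup>+x. f x * indicator C (\<phi> x) \<partial>M)" if "C \<in> sets M" for C
    using N[of "indicator C"] that by (simp add: N_def)
  have ac: "absolutely_continuous M N"
    unfolding absolutely_continuous_def
  proof
    fix C assume C: "C \<in> null_sets M"
    then have [measurable]: "C \<in> sets M" by auto
    have "C \<in> null_sets (distr M M \<phi>)"
      using nonsingular C by (auto simp: nonsingular_def absolutely_continuous_def)
    then have "AE x in M. \<phi> x \<notin> C"
      using AE_distrD[OF measurable_nonsingular AE_not_in] by blast
    then have "(\<integral>\<^sup>+x. f x * indicator C (\<phi> x) \<partial>M) = 0"
      by (subst nn_integral_0_iff_AE) auto
    then show "C \<in> null_sets N" using emN[of C] by (auto simp: null_sets_def N_def)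
  qed
  have k: "emeasure N C = (\<integral>\<^sup>+x. k x * indicator C x \<partial>M)" if [measurable]: "C \<in> sets M" for C
  proof -
    have "emeasure N C = emeasure (density M k) C"
      unfolding k_def by (subst density_RN_deriv[OF ac]) (auto simp: N_def)
    then show ?thesis by (simp add: emeasure_density)
  qed
  \<comment> \<open>By the change of variables, \<phi> almost never takes values in the zero set of
    \<open>h\<close>, so \<open>N\<close> gives that set no mass.\<close>
  have "AE x in M. h x = 0 \<longrightarrow> k x = 0"
  proof -
    let ?Z = "{x \<in> space M. h x = 0}"
    have "(\<integral>\<^sup>+x. indicator ?Z (\<phi> x) \<partial>M) = (\<integral>\<^sup>+x. h x * indicator ?Z x \<partial>M)"
      unfolding h_def by (rule nn_integral_RN_comp) measurable
    also have "\<dots> = 0" by (auto simp: nn_integral_0_iff_AE indicator_def)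
    finally have "AE x in M. indicator ?Z (\<phi> x) = (0::ennreal)"
      by (subst (asm) nn_integral_0_iff_AE) auto
    then have "(\<integral>\<^sup>+x. f x * indicator ?Z (\<phi> x) \<partial>M) = 0"
      by (subst nn_integral_0_iff_AE) auto
    then have "(\<integral>\<^sup>+x. k x * indicator ?Z x \<partial>M) = 0"
      using emN[of ?Z] k[of ?Z] by simp
    then have "AE x in M. k x * indicator ?Z x = 0"
      by (subst (asm) nn_integral_0_iff_AE) auto
    then show ?thesis
      using AE_space by eventually_elim auto
  qed
  then have hF: "AE x in M. h x * F x = k x"
    using RN_comp_finite unfolding h_def[symmetric]
  proof eventually_elim
    case (elim x)
    then show ?case
      by (auto simp: F_def mult.commute[of "h x"] ennreal_divide_times ennreal_divide_self less_top)
  qed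
  have "AE x in M. F (\<phi> x) = nn_cond_exp M (pullback_algebra M \<phi>) f x"
  proof (rule E.nn_cond_exp_charact)
    show "(\<lambda>x. F (\<phi> x)) \<in> borel_measurable (pullback_algebra M \<phi>)"
      using measurable_pullback by measurable
    fix G assume "G \<in> sets (pullback_algebra M \<phi>)"
    then obtain C where [measurable]: "C \<in> sets M" and G: "G = \<phi> -` C \<inter> space M"
      by (auto simp: sets_pullback_algebra)
    have ind: "indicator G x = (indicator C (\<phi> x) :: ennreal)" if "x \<in> space M" for x
      using that by (auto simp: G indicator_def)
    have "(\<integral>\<^sup>+x. f x * indicator G x \<partial>M) = (\<integral>\<^sup>+x. k x * indicator C x \<partial>M)"
      unfolding k[symmetric, OF \<open>C \<in> sets M\<close>] emN[OF \<open>C \<in> sets M\<close>]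
      by (intro nn_integral_cong) (simp add: ind)
    also have "\<dots> = (\<integral>\<^sup>+x. h x * (F x * indicator C x) \<partial>M)"
      using hF by (intro nn_integral_cong_AE) (auto simp: mult.assoc[symmetric])
    also have "\<dots> = (\<integral>\<^sup>+x. F (\<phi> x) * indicator C (\<phi> x) \<partial>M)"
      unfolding h_def by (rule nn_integral_RN_comp[symmetric]) measurable
    also have "\<dots> = (\<integral>\<^sup>+x. F (\<phi> x) * indicator G x \<partial>M)"
      by (intro nn_integral_cong) (simp add: ind)
    finally show "(\<integral>\<^sup>+x\<in>G. f x \<partial>M) = (\<integral>\<^sup>+x\<in>G. F (\<phi> x) \<partial>M)" .
  qed measurable
  then have "\<exists>F. F \<in> borel_measurable M \<and> (\<forall>x\<in>space M. RN_comp M \<phi> x = 0 \<longrightarrow> F x = 0) \<and>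
     (AE x in M. nn_cond_exp M (pullback_algebra M \<phi>) f x = F (\<phi> x))"
    by (intro exI[of _ F]) (auto simp: F_def h_def)
  from someI_ex[OF this, folded cond_exp_inv_def]
  show "cond_exp_inv M \<phi> f \<in> borel_measurable M"
    and "AE x in M. nn_cond_exp M (pullback_algebra M \<phi>) f x = cond_exp_inv M \<phi> f (\<phi> x)"
    by blast+
qed

text \<open>Since \<open>g\<close> composed with \<phi> is measurable for the pullback algebra,
  \<open>f\<close> may be replaced by its conditional expectation; the change of variables does the
  rest. Thus each summand of J is the density of the image under \<phi> of a measure
  \<open>density M f\<close>.\<close>

lemma nn_integral_cond_exp_inv:
  assumes [measurable]: "f \<in> borel_measurable M" "g \<in> borel_measurable M"
  shows "(\<integral>\<^sup>+x. g (\<phi> x) * f x \<partial>M) = (\<integral>\<^sup>+x. RN_comp M \<phi> x * cond_exp_inv M \<phi> f x * g x \<partial>M)"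
proof -
  note [measurable] = cond_exp_inv(1)[OF assms(1)] measurable_nonsingular
  have "(\<integral>\<^sup>+x. g (\<phi> x) * f x \<partial>M) = (\<integral>\<^sup>+x. g (\<phi> x) * nn_cond_exp M (pullback_algebra M \<phi>) f x \<partial>M)"
    by (intro E.nn_cond_exp_intg[symmetric] measurable_compose[OF measurable_pullback] assms)
  also have "\<dots> = (\<integral>\<^sup>+x. g (\<phi> x) * cond_exp_inv M \<phi> f (\<phi> x) \<partial>M)"
    using cond_exp_inv(2)[OF assms(1)] by (intro nn_integral_cong_AE) auto
  also have "\<dots> = (\<integral>\<^sup>+x. RN_comp M \<phi> x * (g x * cond_exp_inv M \<phi> f x) \<partial>M)"
    by (rule nn_integral_RN_comp) measurable
  finally show ?thesis by (simp add: mult_ac)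
qed

text \<open>The previous identity is tested on the indicator of \<open>Z\<close>. It will be used to
  pass from zeros of a summand of J to zeros of the corresponding weight.\<close>

lemma AE_vanish_if_cond_exp_inv_vanish:
  assumes [measurable]: "f \<in> borel_measurable M" "Z \<in> sets M"
    and zero: "AE x in M. x \<in> Z \<longrightarrow> RN_comp M \<phi> x * cond_exp_inv M \<phi> f x = 0"
  shows "AE x in M. \<phi> x \<in> Z \<longrightarrow> f x = 0"
proof -
  note [measurable] = cond_exp_inv(1)[OF assms(1)] measurable_nonsingular
  have "(\<integral>\<^sup>+x. indicator Z (\<phi> x) * f x \<partial>M)
      = (\<integral>\<^sup>+x. RN_comp M \<phi> x * cond_exp_inv M \<phi> f x * indicator Z x \<partial>M)"
    by (rule nn_integral_cond_exp_inv) measurable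
  also have "\<dots> = 0"
    using zero by (subst nn_integral_0_iff_AE) (auto simp: indicator_def)
  finally have "AE x in M. indicator Z (\<phi> x) * f x = 0"
    by (subst (asm) nn_integral_0_iff_AE) auto
  then show ?thesis by eventually_elim (auto simp: indicator_def)
qed

lemma AE_nonsingular:
  assumes "AE x in M. P x"
  shows "AE x in M. P (\<phi> x)"
proof (rule AE_distrD[OF measurable_nonsingular])
  show "AE x in distr M M \<phi>. P x"
    by (rule absolutely_continuous_AE[OF _ _ assms]) (use nonsingular in \<open>auto simp: nonsingular_def\<close>)
qed

end

section \<open>Operators with closed range\<close>

abbreviation Lp_class :: "'a measure \<Rightarrow> real \<Rightarrow> ('a \<Rightarrow> complex) \<Rightarrow> ('a \<Rightarrow> complex) set" where
  "Lp_class M p f \<equiv> Lp_rel M p `` {f}"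

lemma Lp_class_in_Lp: "f \<in> Lp_fun M p \<Longrightarrow> Lp_class M p f \<in> Lp M p"
  unfolding Lp_def by (rule quotientI)

lemma Lp_class_self: "f \<in> Lp_fun M p \<Longrightarrow> f \<in> Lp_class M p f"
  by (simp add: Lp_rel_def)

lemma Lp_classE:
  assumes "F \<in> Lp M p"
  obtains f where "f \<in> Lp_fun M p" "F = Lp_class M p f"
  using assms unfolding Lp_def by (auto elim: quotientE)

lemma Lp_class_eq_iff:
  assumes "f \<in> Lp_fun M p" "g \<in> Lp_fun M p"
  shows "Lp_class M p f = Lp_class M p g \<longleftrightarrow> (AE x in M. f x = g x)"
  using assms eq_equiv_class_iff[OF equiv_Lp_rel assms] by (simp add: Lp_rel_def)

text \<open>Respecting almost everywhere equality lets \<open>Lp_map\<close> be computed on any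
  representative, so statements about classes become statements about functions.\<close>

locale Lp_function_map =
  fixes M :: "'a measure" and p q :: real and T :: "('a \<Rightarrow> complex) \<Rightarrow> 'a \<Rightarrow> complex"
  assumes p: "1 \<le> p" and q: "1 \<le> q"
    and maps: "f \<in> Lp_fun M p \<Longrightarrow> T f \<in> Lp_fun M q"
    and cong: "f \<in> Lp_fun M p \<Longrightarrow> g \<in> Lp_fun M p \<Longrightarrow> AE x in M. f x = g x \<Longrightarrow> AE x in M. T f x = T g x"
begin

lemma Lp_map_class:
  assumes "f \<in> Lp_fun M p"
  shows "Lp_map M q T (Lp_class M p f) = Lp_class M q (T f)"
proof -
  have "(T f, T g) \<in> Lp_rel M q" if "(f, g) \<in> Lp_rel M p" for g
    using that maps cong by (auto simp: Lp_rel_def)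
  then have "Lp_class M q (T g) = Lp_class M q (T f)" if "g \<in> Lp_class M p f" for g
    using that equiv_class_eq[OF equiv_Lp_rel] by (metis Image_singleton_iff)
  moreover have "f \<in> Lp_class M p f" using assms by (rule Lp_class_self)
  ultimately show ?thesis unfolding Lp_map_def by blast
qed

text \<open>In a metric space closedness is sequential; sequences of classes and their limits are
  lifted to representatives.\<close>

lemma closed_range_iff:
  "closed_range M p q (Lp_map M q T) \<longleftrightarrow>
    (\<forall>f g. (\<forall>k. f k \<in> Lp_fun M p) \<and> g \<in> Lp_fun M q \<and>
      (\<lambda>k. Lp_seminorm M q (\<lambda>x. T (f k) x - g x)) \<longlonglongrightarrow> 0 \<longrightarrow>
      (\<exists>h\<in>Lp_fun M p. AE x in M. g x = T h x))" (is "_ \<longleftrightarrow> ?seq")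
proof -
  interpret Lq: Metric_space "Lp M q" "Lp_dist M q" using q by (rule Metric_space_Lp)
  let ?R = "Lp_map M q T ` Lp M p"
  have R: "?R = {Lp_class M q (T f) |f. f \<in> Lp_fun M p}"
  proof (intro set_eqI iffI)
    fix G assume "G \<in> ?R"
    then show "G \<in> {Lp_class M q (T f) |f. f \<in> Lp_fun M p}"
      by (auto elim!: Lp_classE simp: Lp_map_class)
  next
    fix G assume "G \<in> {Lp_class M q (T f) |f. f \<in> Lp_fun M p}"
    then show "G \<in> ?R" by (auto simp: Lp_map_class[symmetric] intro!: imageI Lp_class_in_Lp)
  qed
  have dist: "Lp_dist M q (Lp_class M q (T f)) (Lp_class M q g) = Lp_seminorm M q (\<lambda>x. T f x - g x)"
    if "f \<in> Lp_fun M p" "g \<in> Lp_fun M q" for f g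
    using that by (intro Lp_dist_eq Lp_class_in_Lp Lp_class_self maps)
  have "?R \<subseteq> Lp M q" using maps Lp_class_in_Lp by (auto simp: R)
  then have "closed_range M p q (Lp_map M q T) \<longleftrightarrow>
      (\<forall>\<sigma> l. range \<sigma> \<subseteq> ?R \<and> limitin Lq.mtopology \<sigma> l sequentially \<longrightarrow> l \<in> ?R)"
    by (simp add: closed_range_def Lp_topology_def Lq.metric_closedin_iff_sequentially_closed)
  also have "\<dots> \<longleftrightarrow> ?seq"
  proof safe
    fix f g assume *: "\<forall>\<sigma> l. range \<sigma> \<subseteq> ?R \<and> limitin Lq.mtopology \<sigma> l sequentially \<longrightarrow> l \<in> ?R"
      and f: "\<forall>k. f k \<in> Lp_fun M p" and g: "g \<in> Lp_fun M q"
      and lim: "(\<lambda>k. Lp_seminorm M q (\<lambda>x. T (f k) x - g x)) \<longlonglongrightarrow> 0"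
    have "limitin Lq.mtopology (\<lambda>k. Lp_class M q (T (f k))) (Lp_class M q g) sequentially"
      using f g lim by (simp add: Lq.limitin_metric_dist_null Lp_class_in_Lp maps dist)
    then have "Lp_class M q g \<in> ?R"
      using *[rule_format, of "\<lambda>k. Lp_class M q (T (f k))"] f unfolding R by blast
    then obtain h where "h \<in> Lp_fun M p" "Lp_class M q g = Lp_class M q (T h)" by (auto simp: R)
    then show "\<exists>h\<in>Lp_fun M p. AE x in M. g x = T h x"
      using Lp_class_eq_iff[OF g maps] by blast
  next
    fix \<sigma> l assume *: ?seq and \<sigma>: "range \<sigma> \<subseteq> ?R" and lim: "limitin Lq.mtopology \<sigma> l sequentially"
    have "\<exists>f. f \<in> Lp_fun M p \<and> \<sigma> k = Lp_class M q (T f)" for k :: nat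
      using \<sigma> unfolding R by blast
    then obtain f where f: "\<And>k. f k \<in> Lp_fun M p" "\<And>k. \<sigma> k = Lp_class M q (T (f k))" by metis
    have "l \<in> Lp M q" using lim by (simp add: Lq.limitin_metric_dist_null)
    then obtain g where g: "g \<in> Lp_fun M q" "l = Lp_class M q g" by (rule Lp_classE)
    have "(\<lambda>k. Lp_seminorm M q (\<lambda>x. T (f k) x - g x)) \<longlonglongrightarrow> 0"
      using lim f g by (simp add: Lq.limitin_metric_dist_null dist)
    then obtain h where "h \<in> Lp_fun M p" "AE x in M. g x = T h x" using * f g by blast
    then show "l \<in> ?R" using Lp_class_eq_iff[OF g(1) maps] g unfolding R by blast
  qed
  finally show ?thesis .
qed

lemma bounded_iff:
  "bounded_Lp_operator M p q (Lp_map M q T) \<longleftrightarrow>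
    (\<exists>C. \<forall>f\<in>Lp_fun M p. Lp_seminorm M q (T f) \<le> C * Lp_seminorm M p f)"
proof -
  have norm: "Lp_norm M s (Lp_class M s f) = Lp_seminorm M s f" if "f \<in> Lp_fun M s" for f s
    using that by (intro Lp_norm_eq Lp_class_in_Lp Lp_class_self)
  have "Lp_map M q T \<in> Lp M p \<rightarrow> Lp M q"
    by (auto elim!: Lp_classE simp: Lp_map_class Lp_class_in_Lp maps)
  moreover have "(\<forall>F\<in>Lp M p. Lp_norm M q (Lp_map M q T F) \<le> C * Lp_norm M p F) \<longleftrightarrow>
      (\<forall>f\<in>Lp_fun M p. Lp_seminorm M q (T f) \<le> C * Lp_seminorm M p f)" for C
  proof safe
    fix f assume "\<forall>F\<in>Lp M p. Lp_norm M q (Lp_map M q T F) \<le> C * Lp_norm M p F" "f \<in> Lp_fun M p"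
    then show "Lp_seminorm M q (T f) \<le> C * Lp_seminorm M p f"
      by (metis Lp_class_in_Lp Lp_map_class maps norm)
  next
    fix F assume *: "\<forall>f\<in>Lp_fun M p. Lp_seminorm M q (T f) \<le> C * Lp_seminorm M p f" "F \<in> Lp M p"
    then show "Lp_norm M q (Lp_map M q T F) \<le> C * Lp_norm M p F"
      by (auto elim!: Lp_classE simp: Lp_map_class maps norm)
  qed
  ultimately show ?thesis by (simp add: bounded_Lp_operator_def)
qed

text \<open>\<open>comparable_complete_seminorms\<close> is applied to the p-seminorm of f and the
  q-seminorm of \<open>T f\<close>. Boundedness gives the domination, injectivity the condition on
  kernels, and closed range the completeness of the second seminorm.\<close>

lemma bounded_below:
  assumes lin: "linear T"
    and bounded: "bounded_Lp_operator M p q (Lp_map M q T)"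
    and closed: "closed_range M p q (Lp_map M q T)"
    and inj: "inj_on (Lp_map M q T) (Lp M p)"
  shows "\<exists>c>0. \<forall>f\<in>Lp_fun M p. Lp_seminorm M p f \<le> c * Lp_seminorm M q (T f)"
proof -
  obtain C where C: "\<And>f. f \<in> Lp_fun M p \<Longrightarrow> Lp_seminorm M q (T f) \<le> C * Lp_seminorm M p f"
    using bounded bounded_iff by blast
  interpret Lp: complete_seminorm_on "Lp_fun M p" "Lp_seminorm M p"
    using p by (rule complete_seminorm_on_Lp)
  interpret Lq: complete_seminorm_on "Lp_fun M q" "Lp_seminorm M q"
    using q by (rule complete_seminorm_on_Lp)
  have "complete_seminorm_on (Lp_fun M p) (\<lambda>f. Lp_seminorm M q (T f))"
  proof
    show "subspace (Lp_fun M p)" by (rule Lp.subspace)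
    show "Lp_seminorm M q (T (f + g)) \<le> Lp_seminorm M q (T f) + Lp_seminorm M q (T g)"
      if "f \<in> Lp_fun M p" "g \<in> Lp_fun M p" for f g
      unfolding linear_add[OF lin] using that by (intro Lq.triangle maps)
    show "Lp_seminorm M q (T (c *\<^sub>R f)) = \<bar>c\<bar> * Lp_seminorm M q (T f)"
      if "f \<in> Lp_fun M p" for f c
      unfolding linear_scale[OF lin] using that by (intro Lq.scale maps)
    fix s :: "nat \<Rightarrow> 'a \<Rightarrow> complex" and K
    assume s: "\<And>k. s k \<in> Lp_fun M p"
      and rapid: "\<And>k. Lp_seminorm M q (T (s (Suc k) - s k)) \<le> K * (1 / 2) ^ k"
    \<comment> \<open>The images converge in the complete space on the target side; closed range
      then identifies the limit as an image \<open>T h\<close>.\<close>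
    have "\<exists>g\<in>Lp_fun M q. (\<lambda>k. Lp_seminorm M q (T (s k) - g)) \<longlonglongrightarrow> 0"
      using rapid unfolding linear_diff[OF lin] by (intro Lq.complete maps s)
    then obtain g where g: "g \<in> Lp_fun M q" "(\<lambda>k. Lp_seminorm M q (\<lambda>x. T (s k) x - g x)) \<longlonglongrightarrow> 0"
      by (auto simp: fun_diff_def)
    then obtain h where h: "h \<in> Lp_fun M p" "AE x in M. g x = T h x"
      using closed s unfolding closed_range_iff by blast
    have eq: "Lp_seminorm M q (T (s k - h)) = Lp_seminorm M q (\<lambda>x. T (s k) x - g x)" for k
      unfolding linear_diff[OF lin] fun_diff_def[of "T (s k)"] using h(2)
      by (intro Lp_seminorm_cong Lp_fun_measurable[OF Lp_fun_diff[OF q]] maps s h(1) g(1)) auto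
    then show "\<exists>h\<in>Lp_fun M p. (\<lambda>k. Lp_seminorm M q (T (s k - h))) \<longlonglongrightarrow> 0"
      using g(2) h(1) by (intro bexI[of _ h]) (simp_all only: eq)
  qed
  moreover have "Lp_seminorm M p f = 0" if f: "f \<in> Lp_fun M p" and "Lp_seminorm M q (T f) = 0" for f
  proof -
    have "T (\<lambda>x. 0) = (\<lambda>x. 0)" using linear_0[OF lin] by (simp add: zero_fun_def)
    moreover have "AE x in M. T f x = 0"
      using that Lp_seminorm_eq_0_iff[OF q maps[OF f]] by simp
    ultimately have "Lp_class M q (T f) = Lp_class M q (T (\<lambda>x. 0))"
      using Lp_class_eq_iff[OF maps[OF f] maps[OF Lp_fun_zero]] by simp
    then have "Lp_class M p f = Lp_class M p (\<lambda>x. 0)"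
      using inj f Lp_fun_zero by (metis Lp_class_in_Lp Lp_map_class inj_onD)
    then show ?thesis
      using Lp_class_eq_iff[OF f Lp_fun_zero] Lp_seminorm_eq_0_iff[OF p f] by simp
  qed
  ultimately show ?thesis
    using comparable_complete_seminorms[OF Lp.complete_seminorm_on_axioms _ C] by blast
qed

end

section \<open>Sums of few nonzero terms\<close>

text \<open>Among the two partial sums that differ by \<open>z j\<close>, one has norm at least \<open>norm (z j) / 2\<close>;
  this replaces averaging over random signs.\<close>

lemma powr_norm_le_subset_sums:
  fixes z :: "'i \<Rightarrow> complex"
  assumes S: "finite S" "j \<in> S" and q: "0 \<le> q"
  shows "2 ^ card S * norm (z j) powr q \<le> 2 * 2 powr q * (\<Sum>R\<in>Pow S. norm (sum z R) powr q)"
proof -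
  define S' where "S' = S - {j}"
  have S': "finite S'" "j \<notin> S'" "S = insert j S'" using S by (auto simp: S'_def)
  have pair: "(norm (z j) / 2) powr q \<le> norm (sum z R) powr q + norm (sum z (insert j R)) powr q"
    if "R \<in> Pow S'" for R
  proof -
    have "finite R" "j \<notin> R" using that S' by (auto intro: finite_subset)
    then have "sum z (insert j R) = z j + sum z R" by simp
    then have "norm (z j) / 2 \<le> norm (sum z R) \<or> norm (z j) / 2 \<le> norm (sum z (insert j R))"
      using norm_triangle_ineq4[of "sum z (insert j R)" "sum z R"] by auto
    then show ?thesis
    proof
      assume "norm (z j) / 2 \<le> norm (sum z R)"
      then have "(norm (z j) / 2) powr q \<le> norm (sum z R) powr q" using q by (intro powr_mono2) auto
      then show ?thesis by (simp add: add_increasing2)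
    next
      assume "norm (z j) / 2 \<le> norm (sum z (insert j R))"
      then have "(norm (z j) / 2) powr q \<le> norm (sum z (insert j R)) powr q"
        using q by (intro powr_mono2) auto
      then show ?thesis by (simp add: add_increasing)
    qed
  qed
  have "2 ^ card S' * (norm (z j) / 2) powr q = (\<Sum>R\<in>Pow S'. (norm (z j) / 2) powr q)"
    using S' by (simp add: card_Pow)
  also have "\<dots> \<le> (\<Sum>R\<in>Pow S'. norm (sum z R) powr q + norm (sum z (insert j R)) powr q)"
    by (intro sum_mono pair)
  also have "\<dots> = (\<Sum>R\<in>Pow S'. norm (sum z R) powr q) + (\<Sum>R\<in>insert j ` Pow S'. norm (sum z R) powr q)"
    using S' by (subst sum.reindex) (auto simp: sum.distrib inj_on_def)
  also have "\<dots> = (\<Sum>R\<in>Pow S. norm (sum z R) powr q)"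
    using S' unfolding S'(3) Pow_insert by (subst sum.union_disjoint) auto
  \<comment> \<open>One factor 2 accounts for \<open>card S\<close> being one more than
    \<open>card S'\<close>, the factor \<open>2 powr q\<close> for halving
    \<open>z j\<close>.\<close>
  finally show ?thesis
    using S' by (simp add: powr_divide field_simps)
qed

text \<open>Only the nonzero terms count, and each is bounded by the preceding lemma. The constant
  depends on their number, not on the size of \<open>S\<close>.\<close>

lemma sum_powr_norm_le_subset_sums:
  fixes z :: "'i \<Rightarrow> complex"
  assumes S: "finite S" and n: "card {j \<in> S. z j \<noteq> 0} \<le> n" and q: "0 \<le> q"
  shows "2 ^ card S * (\<Sum>j\<in>S. norm (z j) powr q)
    \<le> real n * (2 * 2 powr q) * (\<Sum>R\<in>Pow S. norm (sum z R) powr q)"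
proof -
  let ?P = "2 * 2 powr q * (\<Sum>R\<in>Pow S. norm (sum z R) powr q)"
  have "2 ^ card S * (\<Sum>j\<in>S. norm (z j) powr q) = (\<Sum>j | j \<in> S \<and> z j \<noteq> 0. 2 ^ card S * norm (z j) powr q)"
    unfolding sum_distrib_left using S by (intro sum.mono_neutral_right) auto
  also have "\<dots> \<le> (\<Sum>j | j \<in> S \<and> z j \<noteq> 0. ?P)"
    by (intro sum_mono powr_norm_le_subset_sums S q) auto
  also have "\<dots> = real (card {j \<in> S. z j \<noteq> 0}) * ?P" by simp
  also have "\<dots> \<le> real n * ?P"
    using n by (intro mult_right_mono) (auto intro!: mult_nonneg_nonneg sum_nonneg)
  finally show ?thesis by (simp add: mult_ac)
qed

text \<open>The pointwise inequality is integrated. After division by \<open>2 ^ card S\<close> the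
  right side is a multiple of the average over all subsets, which takes the place of choosing one
  good subset.\<close>

lemma Lp_sum_powr_le_subset_sums:
  fixes v :: "'i \<Rightarrow> 'a \<Rightarrow> complex"
  assumes q: "1 \<le> q" and S: "finite S" and v: "\<And>j. j \<in> S \<Longrightarrow> v j \<in> Lp_fun M q"
    and n: "\<And>x. x \<in> space M \<Longrightarrow> card {j \<in> S. v j x \<noteq> 0} \<le> n"
  shows "2 ^ card S * (\<Sum>j\<in>S. Lp_seminorm M q (v j) powr q)
    \<le> real n * (2 * 2 powr q) * (\<Sum>R\<in>Pow S. Lp_seminorm M q (\<lambda>x. \<Sum>j\<in>R. v j x) powr q)"
proof -
  have q0: "0 < q" using q by simp
  have int1: "integrable M (\<lambda>x. norm (v j x) powr q)" if "j \<in> S" for j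
    using v[OF that] by (rule Lp_fun_integrable)
  have int2: "integrable M (\<lambda>x. norm (\<Sum>j\<in>R. v j x) powr q)" if "R \<in> Pow S" for R
  proof -
    have "(\<lambda>x. \<Sum>j\<in>R. v j x) \<in> Lp_fun M q"
      using that by (intro Lp_fun_sum q v) auto
    then show ?thesis by (rule Lp_fun_integrable)
  qed
  have "2 ^ card S * (\<Sum>j\<in>S. Lp_seminorm M q (v j) powr q)
      = (\<integral>x. 2 ^ card S * (\<Sum>j\<in>S. norm (v j x) powr q) \<partial>M)"
    by (simp add: Lp_seminorm_powr[OF q0] Bochner_Integration.integral_sum[OF int1] del: Pow_iff)
  also have "\<dots> \<le> (\<integral>x. real n * (2 * 2 powr q) * (\<Sum>R\<in>Pow S. norm (\<Sum>j\<in>R. v j x) powr q) \<partial>M)"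
  proof (rule integral_mono)
    show "integrable M (\<lambda>x. 2 ^ card S * (\<Sum>j\<in>S. norm (v j x) powr q))"
      using int1 by simp
    show "integrable M (\<lambda>x. real n * (2 * 2 powr q) * (\<Sum>R\<in>Pow S. norm (\<Sum>j\<in>R. v j x) powr q))"
      by (rule integrable_mult_right, rule Bochner_Integration.integrable_sum, rule int2)
    fix x assume "x \<in> space M"
    then show "2 ^ card S * (\<Sum>j\<in>S. norm (v j x) powr q)
        \<le> real n * (2 * 2 powr q) * (\<Sum>R\<in>Pow S. norm (\<Sum>j\<in>R. v j x) powr q)"
      using q0 by (intro sum_powr_norm_le_subset_sums S n) auto
  qed
  also have "\<dots> = real n * (2 * 2 powr q) * (\<Sum>R\<in>Pow S. Lp_seminorm M q (\<lambda>x. \<Sum>j\<in>R. v j x) powr q)"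
    by (simp add: Lp_seminorm_powr[OF q0] Bochner_Integration.integral_sum[OF int2] del: Pow_iff)
  finally show ?thesis .
qed

definition normalized_indicator :: "'a measure \<Rightarrow> real \<Rightarrow> 'a set \<Rightarrow> 'a \<Rightarrow> complex" where
  "normalized_indicator M p A x = indicator A x / of_real (measure M A powr (1 / p))"

text \<open>By disjointness at most one term is nonzero at each point, so the p-th power passes
  through the sum and each term integrates to 1.\<close>

lemma normalized_indicator_sum:
  assumes p: "0 < p" and R: "finite R" "disjoint_family_on A R"
    and A: "\<And>i. i \<in> R \<Longrightarrow> A i \<in> sets M" "\<And>i. i \<in> R \<Longrightarrow> 0 < emeasure M (A i)"
      "\<And>i. i \<in> R \<Longrightarrow> emeasure M (A i) < \<infinity>"
  shows "(\<lambda>x. \<Sum>i\<in>R. normalized_indicator M p (A i) x) \<in> Lp_fun M p"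
    and "Lp_seminorm M p (\<lambda>x. \<Sum>i\<in>R. normalized_indicator M p (A i) x) = real (card R) powr (1 / p)"
proof -
  have pos: "0 < measure M (A i)" if "i \<in> R" for i
    using A(2,3)[OF that] by (simp add: measure_def enn2real_positive_iff)
  have eq: "norm (\<Sum>i\<in>R. normalized_indicator M p (A i) x) powr p
      = (\<Sum>i\<in>R. indicator (A i) x / measure M (A i))" for x
  proof (cases "\<exists>i\<in>R. x \<in> A i")
    case True
    then obtain i where i: "i \<in> R" "x \<in> A i" by blast
    have other: "x \<notin> A k" if "k \<in> R - {i}" for k
      using R(2) i that by (auto simp: disjoint_family_on_def)
    have "(\<Sum>k\<in>R. normalized_indicator M p (A k) x) = normalized_indicator M p (A i) x"
      "(\<Sum>k\<in>R. indicator (A k) x / measure M (A k)) = 1 / measure M (A i)"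
      using i other R(1) by (simp_all add: sum.remove[OF R(1) i(1)] normalized_indicator_def)
    then show ?thesis
      using i p pos[OF i(1)]
      by (simp add: normalized_indicator_def norm_divide powr_divide powr_powr)
  qed (use p in \<open>auto simp: normalized_indicator_def\<close>)
  have [measurable]: "(\<lambda>x. \<Sum>i\<in>R. normalized_indicator M p (A i) x) \<in> borel_measurable M"
    unfolding normalized_indicator_def using A(1) by measurable
  have int: "integrable M (\<lambda>x. indicator (A i) x / measure M (A i))" if "i \<in> R" for i
    using A(1,3)[OF that] by (intro integrable_divide integrable_real_indicator) auto
  show L: "(\<lambda>x. \<Sum>i\<in>R. normalized_indicator M p (A i) x) \<in> Lp_fun M p"
    using int by (auto simp: Lp_fun_def eq intro!: Bochner_Integration.integrable_sum)
  have "(\<integral>x. (\<Sum>i\<in>R. indicator (A i) x / measure M (A i)) \<partial>M)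
      = (\<Sum>i\<in>R. \<integral>x. indicator (A i) x / measure M (A i) \<partial>M)"
    using int by (rule Bochner_Integration.integral_sum)
  also have "\<dots> = (\<Sum>i\<in>R. 1)"
  proof (rule sum.cong[OF refl])
    fix i assume i: "i \<in> R"
    have "space M \<inter> A i = A i" using sets.sets_into_space[OF A(1)[OF i]] by blast
    then show "(\<integral>x. indicator (A i) x / measure M (A i) \<partial>M) = 1"
      using pos[OF i] A(1)[OF i] by (simp add: Int_commute)
  qed
  finally show "Lp_seminorm M p (\<lambda>x. \<Sum>i\<in>R. normalized_indicator M p (A i) x) = real (card R) powr (1 / p)"
    by (simp add: Lp_seminorm_def eq)
qed

section \<open>Sums of weighted composition operators\<close>

lemma linear_weighted_comp_sum: "linear (weighted_comp_sum n u \<phi>)"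
  by (rule linearI)
    (simp_all add: weighted_comp_sum_def fun_eq_iff scaleR_fun_def distrib_left sum.distrib scaleR_sum_right)

lemma weighted_comp_sum_linear_combination:
  "weighted_comp_sum n u \<phi> (\<lambda>x. \<Sum>i\<in>S. c i * f i x) = (\<lambda>x. \<Sum>i\<in>S. c i * weighted_comp_sum n u \<phi> (f i) x)"
  unfolding weighted_comp_sum_def sum_distrib_left
  by (subst sum.swap) (simp add: mult_ac)

section \<open>The operator under the hypotheses of the theorem\<close>

context
  fixes M :: "'a measure" and n :: nat and u :: "nat \<Rightarrow> 'a \<Rightarrow> complex" and \<phi> :: "nat \<Rightarrow> 'a \<Rightarrow> 'a"
    and p q :: real
  assumes sigma_finite: "sigma_finite_measure M"
    and u: "\<And>r. r \<in> {1..n} \<Longrightarrow> u r \<in> borel_measurable M"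
    and nonsingular: "\<And>r. r \<in> {1..n} \<Longrightarrow> nonsingular M (\<phi> r)"
    and subalgebra: "\<And>r. r \<in> {1..n} \<Longrightarrow> sigma_finite_subalgebra M (pullback_algebra M (\<phi> r))"
    and q: "1 \<le> q" and qp: "q < p"
    and bounded: "bounded_Lp_operator M p q (Lp_map M q (weighted_comp_sum n u \<phi>))"
begin

lemma measurable_weighted_comp_sum:
  assumes "f \<in> borel_measurable M"
  shows "weighted_comp_sum n u \<phi> f \<in> borel_measurable M"
  unfolding weighted_comp_sum_def
  using nonsingular
  by (intro borel_measurable_sum borel_measurable_times u measurable_compose[OF _ assms])
    (auto simp: nonsingular_def)

lemma AE_comp_all:
  assumes "AE x in M. P x"
  shows "AE x in M. \<forall>r\<in>{1..n}. P (\<phi> r x)"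
  using AE_nonsingular[OF sigma_finite nonsingular subalgebra assms]
  by (intro AE_finite_allI) auto

lemma weighted_comp_sum_cong_AE:
  assumes "AE x in M. f x = g x"
  shows "AE x in M. weighted_comp_sum n u \<phi> f x = weighted_comp_sum n u \<phi> g x"
  using AE_comp_all[OF assms] by eventually_elim (simp add: weighted_comp_sum_def)

text \<open>Boundedness is a statement about classes and yields an image in
  \<open>Lp_fun M q\<close> for some representative g of the class of f. Non-singularity makes the
  images of f and g agree almost everywhere, so the image of f lies there too.\<close>

lemma Lp_function_map_weighted_comp_sum: "Lp_function_map M p q (weighted_comp_sum n u \<phi>)"
proof
  let ?T = "weighted_comp_sum n u \<phi>"
  show "1 \<le> p" "1 \<le> q" using q qp by auto
  show "?T f \<in> Lp_fun M q" if f: "f \<in> Lp_fun M p" for f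
  proof -
    have "Lp_map M q ?T (Lp_class M p f) \<in> Lp M q"
      using bounded Lp_class_in_Lp[OF f] by (auto simp: bounded_Lp_operator_def)
    then obtain k where "k \<in> Lp_map M q ?T (Lp_class M p f)" using Lp_rep(1) by blast
    then obtain g where g: "(f, g) \<in> Lp_rel M p" "(?T g, k) \<in> Lp_rel M q"
      by (auto simp: Lp_map_def)
    have "AE x in M. g x = f x" using g(1) by (auto simp: Lp_rel_def elim: eventually_mono)
    then have "AE x in M. ?T g x = ?T f x" by (rule weighted_comp_sum_cong_AE)
    moreover have "?T g \<in> Lp_fun M q" using g(2) by (simp add: Lp_rel_def)
    ultimately show ?thesis
      by (rule Lp_fun_cong[OF _ measurable_weighted_comp_sum[OF Lp_fun_measurable[OF f]], rotated])
  qed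
qed (rule weighted_comp_sum_cong_AE)

interpretation Lp_function_map M p q "weighted_comp_sum n u \<phi>"
  by (rule Lp_function_map_weighted_comp_sum)

section \<open>Lower bounds and the number of atoms\<close>

lemma finite_atoms_if_bounded_below:
  assumes A: "\<And>i. i \<in> I \<Longrightarrow> A i \<in> sets M" "\<And>i. i \<in> I \<Longrightarrow> 0 < emeasure M (A i)"
      "\<And>i. i \<in> I \<Longrightarrow> emeasure M (A i) < \<infinity>"
    and disj: "disjoint_family_on A I"
    and c: "c > 0" "\<And>f. f \<in> Lp_fun M p \<Longrightarrow>
      Lp_seminorm M p f \<le> c * Lp_seminorm M q (weighted_comp_sum n u \<phi> f)"
  shows "finite I"
proof (rule ccontr)
  assume inf: "infinite I"
  let ?T = "weighted_comp_sum n u \<phi>"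
  have p0: "0 < p" and q0: "0 < q" using q qp by auto
  obtain C0 where C0: "\<And>f. f \<in> Lp_fun M p \<Longrightarrow> Lp_seminorm M q (?T f) \<le> C0 * Lp_seminorm M p f"
    using bounded bounded_iff by blast
  define C where "C = max C0 0"
  have C: "0 \<le> C" "Lp_seminorm M q (?T f) \<le> C * Lp_seminorm M p f" if "f \<in> Lp_fun M p" for f
    using order_trans[OF C0[OF that] mult_right_mono[of C0 C]] Lp_seminorm_nonneg
    by (auto simp: C_def)
  define e where "e i = normalized_indicator M p (A i)" for i
  define D where "D = c powr q * (real n * (2 * 2 powr q) * C powr q)"
  \<comment> \<open>Subset sums are compared for m atoms. The lower bound on each \<open>e j\<close>
    makes the sum of q-th powers at least m times \<open>(1 / c) powr q\<close>, while boundedness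
    keeps the average over subsets below a constant times \<open>m powr (q / p)\<close>.\<close>
  have bound: "real m powr (1 - q / p) \<le> D" if m: "m > 0" for m
  proof -
    obtain S where S: "S \<subseteq> I" "finite S" "card S = m"
      using infinite_arbitrarily_large[OF inf] by blast
    have sub: "finite R" "disjoint_family_on A R" "R \<subseteq> I" "card R \<le> m" if "R \<subseteq> S" for R
      using that S disj by (auto intro: finite_subset disjoint_family_on_mono card_mono)
    have e_sum: "(\<lambda>x. \<Sum>i\<in>R. e i x) \<in> Lp_fun M p"
      "Lp_seminorm M p (\<lambda>x. \<Sum>i\<in>R. e i x) = real (card R) powr (1 / p)" if "R \<subseteq> S" for R
      using normalized_indicator_sum[OF p0 sub(1,2)[OF that] A] sub(3)[OF that]
      unfolding e_def by auto
    have e: "e i \<in> Lp_fun M p" "Lp_seminorm M p (e i) = 1" if "i \<in> S" for i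
      using e_sum[of "{i}"] that by auto
    \<comment> \<open>For each r the point \<open>\<phi> r x\<close> lies in at most one of the
      disjoint sets, so each r contributes at most one index j.\<close>
    have few: "card {j \<in> S. ?T (e j) x \<noteq> 0} \<le> n" for x
    proof -
      have "{j \<in> S. ?T (e j) x \<noteq> 0} \<subseteq> (\<Union>r\<in>{1..n}. {j \<in> S. \<phi> r x \<in> A j})"
      proof
        fix j assume j: "j \<in> {j \<in> S. ?T (e j) x \<noteq> 0}"
        then have "(\<Sum>r = 1..n. u r x * e j (\<phi> r x)) \<noteq> 0" by (simp add: weighted_comp_sum_def)
        then obtain r where r: "r \<in> {1..n}" "u r x * e j (\<phi> r x) \<noteq> 0"
          by (rule sum.not_neutral_contains_not_neutral)
        then have "\<phi> r x \<in> A j" by (auto simp: e_def normalized_indicator_def indicator_def split: if_splits)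
        then show "j \<in> (\<Union>r\<in>{1..n}. {j \<in> S. \<phi> r x \<in> A j})" using j r by blast
      qed
      then have "card {j \<in> S. ?T (e j) x \<noteq> 0} \<le> card (\<Union>r\<in>{1..n}. {j \<in> S. \<phi> r x \<in> A j})"
        using S(2) by (intro card_mono) auto
      also have "\<dots> \<le> (\<Sum>r\<in>{1..n}. card {j \<in> S. \<phi> r x \<in> A j})"
        by (rule card_UN_le) simp
      also have "\<dots> \<le> (\<Sum>r\<in>{1..n}. 1)"
      proof (rule sum_mono)
        fix r
        have "i = j" if "i \<in> S" "j \<in> S" "\<phi> r x \<in> A i" "\<phi> r x \<in> A j" for i j
          using that sub(2)[of S] by (auto simp: disjoint_family_on_def)
        then show "card {j \<in> S. \<phi> r x \<in> A j} \<le> 1"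
          using S(2) by (subst card_le_Suc0_iff_eq[folded One_nat_def]) auto
      qed
      finally show ?thesis by simp
    qed
    have lower: "(1 / c) powr q \<le> Lp_seminorm M q (?T (e j)) powr q" if "j \<in> S" for j
      using c(2)[OF e(1)[OF that]] e(2)[OF that] c(1) q0
      by (intro powr_mono2) (auto simp: field_simps)
    have upper: "Lp_seminorm M q (\<lambda>x. \<Sum>j\<in>R. ?T (e j) x) powr q \<le> C powr q * real m powr (q / p)"
      if R: "R \<in> Pow S" for R
    proof -
      have "(\<lambda>x. \<Sum>j\<in>R. ?T (e j) x) = ?T (\<lambda>x. \<Sum>j\<in>R. e j x)"
        using weighted_comp_sum_linear_combination[where S = R and c = "\<lambda>_. 1" and f = e] by simp
      then have "Lp_seminorm M q (\<lambda>x. \<Sum>j\<in>R. ?T (e j) x) \<le> C * real (card R) powr (1 / p)"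
        using C(2)[OF e_sum(1)] e_sum(2) R by simp
      also have "\<dots> \<le> C * real m powr (1 / p)"
        using C(1)[OF Lp_fun_zero] sub(4)[of R] R p0 by (intro mult_left_mono powr_mono2) auto
      finally have "Lp_seminorm M q (\<lambda>x. \<Sum>j\<in>R. ?T (e j) x) powr q \<le> (C * real m powr (1 / p)) powr q"
        using q0 by (intro powr_mono2 Lp_seminorm_nonneg) auto
      then show ?thesis by (simp add: powr_mult powr_powr)
    qed
    have "2 ^ m * (real m * (1 / c) powr q) = 2 ^ card S * (\<Sum>j\<in>S. (1 / c) powr q)"
      using S by simp
    also have "\<dots> \<le> 2 ^ card S * (\<Sum>j\<in>S. Lp_seminorm M q (?T (e j)) powr q)"
      by (intro mult_left_mono sum_mono lower) auto
    also have "\<dots> \<le> real n * (2 * 2 powr q) *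
        (\<Sum>R\<in>Pow S. Lp_seminorm M q (\<lambda>x. \<Sum>j\<in>R. ?T (e j) x) powr q)"
      by (intro Lp_sum_powr_le_subset_sums q S(2) maps e few)
    also have "\<dots> \<le> real n * (2 * 2 powr q) * (\<Sum>R\<in>Pow S. C powr q * real m powr (q / p))"
      by (intro mult_left_mono sum_mono upper) auto
    also have "\<dots> = 2 ^ m * (real n * (2 * 2 powr q) * C powr q * real m powr (q / p))"
      using S by (simp add: card_Pow)
    finally have "real m * (1 / c) powr q \<le> real n * (2 * 2 powr q) * C powr q * real m powr (q / p)"
      by simp
    then have "real m \<le> D * real m powr (q / p)"
      using c(1) by (simp add: D_def powr_divide field_simps)
    then show ?thesis
      using m by (simp add: powr_diff field_simps)
  qed
  \<comment> \<open>The strict inequality between q and p makes this exponent positive, so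
    \<open>bound\<close> fails for large m.\<close>
  define t where "t = 1 - q / p"
  have t: "0 < t" using qp p0 by (simp add: t_def)
  obtain m :: nat where m: "D powr (1 / t) < real m" using reals_Archimedean2 by blast
  then have "0 < real m" using powr_ge_zero[of D "1 / t"] by linarith
  then have "(real m powr t) powr (1 / t) \<le> D powr (1 / t)"
    using bound t by (intro powr_mono2) (auto simp: t_def)
  then show False using m t by (simp add: powr_powr)
qed

section \<open>The function J and the range of the operator\<close>

lemma J_fun_measurable: "J_fun M q n u \<phi> \<in> borel_measurable M"
  unfolding J_fun_def
proof (intro borel_measurable_sum borel_measurable_times_ennreal)
  fix r assume r: "r \<in> {1..n}"
  note [measurable] = u[OF r]
  show "RN_comp M (\<phi> r) \<in> borel_measurable M" by (simp add: RN_comp_def)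
  show "cond_exp_inv M (\<phi> r) (\<lambda>y. ennreal (norm (u r y) powr q)) \<in> borel_measurable M"
    using sigma_finite nonsingular[OF r] subalgebra[OF r] by (rule cond_exp_inv) measurable
qed

text \<open>The summands of J are nonnegative, so where J is 0 all of them are. Hence each
  \<open>u r\<close> vanishes almost everywhere that \<open>\<phi> r\<close> lands in the support of
  \<open>g\<close>, and every term of the operator is 0 separately.\<close>

lemma weighted_comp_sum_eq_0_if_J_fun_eq_0:
  assumes [measurable]: "g \<in> borel_measurable M"
    and zero: "AE x in M. g x = 0 \<or> J_fun M q n u \<phi> x = 0"
  shows "AE x in M. weighted_comp_sum n u \<phi> g x = 0"
proof -
  let ?Z = "{x \<in> space M. g x \<noteq> 0}"
  have "AE x in M. \<phi> r x \<in> ?Z \<longrightarrow> ennreal (norm (u r x) powr q) = 0" if r: "r \<in> {1..n}" for r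
  proof (rule AE_vanish_if_cond_exp_inv_vanish[OF sigma_finite nonsingular[OF r] subalgebra[OF r]])
    note [measurable] = u[OF r]
    show "(\<lambda>x. ennreal (norm (u r x) powr q)) \<in> borel_measurable M" by measurable
    show "?Z \<in> sets M" by measurable
    show "AE x in M. x \<in> ?Z \<longrightarrow> RN_comp M (\<phi> r) x *
        cond_exp_inv M (\<phi> r) (\<lambda>y. ennreal (norm (u r y) powr q)) x = 0"
      using zero
    proof eventually_elim
      case (elim x)
      then show ?case using r by (auto simp: J_fun_def)
    qed
  qed
  then have "AE x in M. \<forall>r\<in>{1..n}. \<phi> r x \<in> ?Z \<longrightarrow> ennreal (norm (u r x) powr q) = 0"
    by (intro AE_finite_allI) auto
  then show ?thesis
    using AE_space
  proof eventually_elim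
    case (elim x)
    have "u r x * g (\<phi> r x) = 0" if r: "r \<in> {1..n}" for r
    proof (cases "g (\<phi> r x) = 0")
      case False
      moreover have "\<phi> r x \<in> space M"
        using nonsingular[OF r] elim(2) by (auto simp: nonsingular_def dest: measurable_space)
      ultimately have "ennreal (norm (u r x) powr q) = 0" using elim(1) r by blast
      then show ?thesis by simp
    qed simp
    then show ?case unfolding weighted_comp_sum_def by (intro sum.neutral) blast
  qed
qed

text \<open>Replacing f by its values on the atoms in \<open>S\<close> changes f only where J is 0.
  The range is thus spanned by the images of finitely many indicators, and
  \<open>finite_span_closed\<close> applies.\<close>

lemma closed_range_if_J_fun_finitely_atomic:
  assumes decomposition: "atomic_decomposition M B I A"
    and B: "AE x in M. x \<in> B \<longrightarrow> J_fun M q n u \<phi> x = 0"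
    and fin: "finite {i \<in> I. 0 < atom_value M (J_fun M q n u \<phi>) (A i)}"
  shows "closed_range M p q (Lp_map M q (weighted_comp_sum n u \<phi>))"
proof -
  let ?T = "weighted_comp_sum n u \<phi>" and ?J = "J_fun M q n u \<phi>"
  define S where "S = {i \<in> I. 0 < atom_value M ?J (A i)}"
  define ind where "ind i = (indicator (A i) :: 'a \<Rightarrow> complex)" for i
  have I: "countable I" by simp
  have A: "is_atom M (A i)" "emeasure M (A i) < \<infinity>" "A i \<in> sets M" if "i \<in> I" for i
    using decomposition that by (auto simp: atomic_decomposition_def is_atom_def)
  have disj: "disjoint_family_on A I" using decomposition by (simp add: atomic_decomposition_def)
  have S: "finite S" "S \<subseteq> I" using fin by (auto simp: S_def)
  have ind: "ind i \<in> Lp_fun M p" if "i \<in> I" for i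
  proof -
    have "norm (ind i x) powr p = indicator (A i) x" for x
      using q qp by (auto simp: ind_def indicator_def)
    then show ?thesis
      using A[OF that] by (auto simp: Lp_fun_def ind_def intro!: integrable_real_indicator)
  qed
  have J: "AE x in M. \<forall>i\<in>I. x \<in> A i \<longrightarrow> ?J x = atom_value M ?J (A i)"
    unfolding AE_ball_countable[OF I] using A J_fun_measurable by (intro ballI atom_value_AE) auto
  have rep: "AE x in M. ?T f x = (\<Sum>i\<in>S. atom_value M f (A i) * ?T (ind i) x)" if f: "f \<in> Lp_fun M p" for f
  proof -
    define s where "s x = (\<Sum>i\<in>S. atom_value M f (A i) * ind i x)" for x
    have s: "s \<in> Lp_fun M p"
      unfolding s_def[abs_def] using q qp S by (intro Lp_fun_sum Lp_fun_scale ind) auto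
    have fA: "AE x in M. \<forall>i\<in>I. x \<in> A i \<longrightarrow> f x = atom_value M f (A i)"
      unfolding AE_ball_countable[OF I] using A Lp_fun_measurable[OF f] by (intro ballI atom_value_AE) auto
    \<comment> \<open>On \<open>B\<close> and on atoms outside \<open>S\<close> the function J is 0;
      on an atom in \<open>S\<close> the step function \<open>s\<close> agrees with f.\<close>
    have "AE x in M. f x - s x = 0 \<or> ?J x = 0"
      using fA J B AE_space
    proof eventually_elim
      case (elim x)
      show ?case
      proof (cases "x \<in> B")
        case False
        then obtain i where i: "i \<in> I" "x \<in> A i"
          using elim(4) decomposition by (auto simp: atomic_decomposition_def)
        show ?thesis
        proof (cases "i \<in> S")
          case True
          have "x \<notin> A k" if "k \<in> S - {i}" for k
            using disjoint_family_onD[OF disj i(1), of k] that i S(2) by auto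
          then have "s x = atom_value M f (A i)"
            using i True by (simp add: s_def ind_def sum.remove[OF S(1) True])
          then show ?thesis using elim(1) i by simp
        next
          case False
          then show ?thesis using elim(2) i by (auto simp: S_def)
        qed
      qed (use elim(3) in blast)
    qed
    then have "AE x in M. ?T (f - s) x = 0"
      using Lp_fun_measurable[OF f] Lp_fun_measurable[OF s]
      by (intro weighted_comp_sum_eq_0_if_J_fun_eq_0) (auto simp: fun_diff_def)
    then have "AE x in M. ?T f x = ?T s x"
      unfolding linear_diff[OF linear_weighted_comp_sum] by simp
    then show ?thesis
      using weighted_comp_sum_linear_combination[where S = S and c = "\<lambda>i. atom_value M f (A i)" and f = ind]
      by (simp add: s_def[abs_def])
  qed
  have T_ind: "?T (ind i) \<in> Lp_fun M q" if "i \<in> S" for i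
    using that S(2) by (intro maps ind) auto
  show ?thesis
    unfolding closed_range_iff
  proof safe
    fix f g assume f: "\<forall>k. f k \<in> Lp_fun M p" and g: "g \<in> Lp_fun M q"
      and lim: "(\<lambda>k. Lp_seminorm M q (\<lambda>x. ?T (f k) x - g x)) \<longlonglongrightarrow> 0"
    have eq: "Lp_seminorm M q (\<lambda>x. ?T (f k) x - g x)
        = Lp_seminorm M q (\<lambda>x. (\<Sum>i\<in>S. atom_value M (f k) (A i) * ?T (ind i) x) - g x)" for k
      using rep[OF f[rule_format, of k]]
      by (intro Lp_seminorm_cong Lp_fun_measurable[OF Lp_fun_diff[OF q]] maps f[rule_format] g
          Lp_fun_sum[OF q] Lp_fun_scale T_ind) auto
    obtain d where d: "AE x in M. g x = (\<Sum>i\<in>S. d i * ?T (ind i) x)"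
      using finite_span_closed[OF q S(1) T_ind g lim[unfolded eq]] by blast
    show "\<exists>h\<in>Lp_fun M p. AE x in M. g x = ?T h x"
    proof (rule bexI)
      show "(\<lambda>x. \<Sum>i\<in>S. d i * ind i x) \<in> Lp_fun M p"
        using q qp S by (intro Lp_fun_sum Lp_fun_scale ind) auto
      show "AE x in M. g x = ?T (\<lambda>x. \<Sum>i\<in>S. d i * ind i x) x"
        using d by (simp add: weighted_comp_sum_linear_combination)
    qed
  qed
qed

text \<open>The lower bound from \<open>bounded_below\<close> forces the whole family of atoms to be
  finite, so the index set in part (a) is a subset of a finite set.\<close>

lemma finite_atoms_if_injective_closed_range:
  assumes decomposition: "atomic_decomposition M B I A"
    and "closed_range M p q (Lp_map M q (weighted_comp_sum n u \<phi>))"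
    and "inj_on (Lp_map M q (weighted_comp_sum n u \<phi>)) (Lp M p)"
  shows "finite I"
proof -
  obtain c where "c > 0" "\<And>f. f \<in> Lp_fun M p \<Longrightarrow>
      Lp_seminorm M p f \<le> c * Lp_seminorm M q (weighted_comp_sum n u \<phi> f)"
    using bounded_below[OF linear_weighted_comp_sum bounded assms(2,3)] by blast
  then show ?thesis
    using decomposition
    by (intro finite_atoms_if_bounded_below[of I A c]) (auto simp: atomic_decomposition_def is_atom_def)
qed

end

theorem theorem2p3:
  fixes M :: "'a measure" and B :: "'a set" and I :: "nat set" and A :: "nat \<Rightarrow> 'a set"
    and p q :: real and n :: nat
    and u :: "nat \<Rightarrow> 'a \<Rightarrow> complex" and \<phi> :: "nat \<Rightarrow> 'a \<Rightarrow> 'a"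
    and W :: "('a \<Rightarrow> complex) set \<Rightarrow> ('a \<Rightarrow> complex) set" and J :: "'a \<Rightarrow> ennreal"
  assumes "sigma_finite_measure M"
    and "atomic_decomposition M B I A"
    and "1 \<le> q" and "q < p" and "1 \<le> n"
    and "\<And>r. r \<in> {1..n} \<Longrightarrow> u r \<in> borel_measurable M"
    and "\<And>r. r \<in> {1..n} \<Longrightarrow> nonsingular M (\<phi> r)"
    and "\<And>r. r \<in> {1..n} \<Longrightarrow> sigma_finite_subalgebra M (pullback_algebra M (\<phi> r))"
    and W_def: "W = Lp_map M q (weighted_comp_sum n u \<phi>)"
    and "bounded_Lp_operator M p q W"
    and J_def: "J = J_fun M q n u \<phi>"
  shows "(closed_range M p q W \<and> inj_on W (Lp M p) \<longrightarrow> finite {i \<in> I. atom_value M J (A i) > 0})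
    \<and> ((AE x in M. x \<in> B \<longrightarrow> J x = 0) \<and> finite {i \<in> I. atom_value M J (A i) > 0}
        \<longrightarrow> closed_range M p q W)"
proof -
  note hyps = assms(1,6,7,8,3,4) assms(10)[unfolded W_def]
  show ?thesis
    unfolding W_def J_def
    using finite_atoms_if_injective_closed_range[OF hyps assms(2)]
      closed_range_if_J_fun_finitely_atomic[OF hyps assms(2)]
    by auto
qed

end
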